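(* Let $N=(N_t)_{t\in\mathbb{R}}$ be a measurable process with stationary increments and finite first moments, and let $\lambda>0$ be a real number. Then $X=(X_t)_{t\in\mathbb{R}}$ given by $$X_t=N_t-\lambda e^{-\lambda t}\int_{-\infty}^t e^{\lambda s}N_s\,ds,\qquad t\in\mathbb{R},$$ (the integral being a pathwise Lebesgue integral, which exists almost surely) is a QOU process driven by $N$ with parameter $\lambda$. Furthermore, any other QOU process driven by $N$ and with parameter $\lambda$ equals $X$ in law. Finally, if $N$ has finite $p$ moments for some $p\ge 1$, then $X$ also has finite $p$ moments and is continuous in $L^p$ (that is, $t\mapsto X_t\in L^p$ is continuous).
   Context: All processes are real-valued and defined on a probability space $(\Omega,\mathcal{F},P)$. A process $Z=(Z_t)_{t\in\mathbb{R}}$ is measurable if $(t,\omega)\mapsto Z_t(\omega)$ is $(\mathcal{B}(\mathbb{R})\otimes\mathcal{F},\mathcal{B}(\mathbb{R}))$-measurable. It has stationary increments if for all $s\in\mathbb{R}$ the process $(Z_t-Z_0)_{t\in\mathbb{R}}$ has the same finite-dimensional distributions as $(Z_{t+s}-Z_s)_{t\in\mathbb{R}}$. For $p>0$, $Z$ has finite $p$ moments if $E[|Z_t|^p]<\infty$ for all $t\in\mathbb{R}$. Equality in law of processes means equality of all finite-dimensional distributions. A QOU (quasi Ornstein--Uhlenbeck) process driven by $N$ with parameter $\lambda>0$ is a stationary solution $X=(X_t)_{t\in\mathbb{R}}$ to the Langevin equation $dX_t=-\lambda X_t\,dt+dN_t$, that is, a stationary process satisfying $$X_t=X_0-\lambda\int_0^t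 X_s\,ds+(N_t-N_0),\qquad t\in\mathbb{R},$$ where the integral is a pathwise Lebesgue integral and $\int_0^t:=-\int_t^0$ for $t<0$. *)

theory Defs
  imports "HOL-Probability.Probability"
begin

text \<open>A process is a function \<open>Z :: real \<Rightarrow> 'a \<Rightarrow> real\<close> on a probability space \<open>M\<close>;
  \<open>Z t \<omega>\<close> is its value at time \<open>t\<close>.\<close>

definition stochastic_process :: "'a measure \<Rightarrow> (real \<Rightarrow> 'a \<Rightarrow> real) \<Rightarrow> bool" where
  "stochastic_process M Z \<longleftrightarrow> (\<forall>t. Z t \<in> borel_measurable M)"

definition measurable_process :: "'a measure \<Rightarrow> (real \<Rightarrow> 'a \<Rightarrow> real) \<Rightarrow> bool" where
  "measurable_process M Z \<longleftrightarrow> (\<lambda>(t, \<omega>). Z t \<omega>) \<in> borel_measurable (borel \<Otimes>\<^sub>M M)"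

text \<open>The law of \<open>(Z t)\<close> for \<open>t\<close> ranging over \<open>J\<close>. Time tuples with repetitions or in another
  order carry no further information, so finite sets of times suffice in \<open>equal_in_law\<close>.
  For non-measurable maps \<open>distr\<close> is junk, so these notions are only meant for functions
  satisfying \<open>stochastic_process\<close>.\<close>

definition fdd :: "'a measure \<Rightarrow> (real \<Rightarrow> 'a \<Rightarrow> real) \<Rightarrow> real set \<Rightarrow> (real \<Rightarrow> real) measure" where
  "fdd M Z J = distr M (\<Pi>\<^sub>M t\<in>J. borel) (\<lambda>\<omega>. \<lambda>t\<in>J. Z t \<omega>)"

definition equal_in_law ::
    "'a measure \<Rightarrow> (real \<Rightarrow> 'a \<Rightarrow> real) \<Rightarrow> (real \<Rightarrow> 'a \<Rightarrow> real) \<Rightarrow> bool" where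
  "equal_in_law M Y Z \<longleftrightarrow> (\<forall>J. finite J \<longrightarrow> fdd M Y J = fdd M Z J)"

definition stationary_process :: "'a measure \<Rightarrow> (real \<Rightarrow> 'a \<Rightarrow> real) \<Rightarrow> bool" where
  "stationary_process M Z \<longleftrightarrow>
     stochastic_process M Z \<and> (\<forall>s. equal_in_law M Z (\<lambda>t. Z (t + s)))"

definition stationary_increments :: "'a measure \<Rightarrow> (real \<Rightarrow> 'a \<Rightarrow> real) \<Rightarrow> bool" where
  "stationary_increments M Z \<longleftrightarrow>
     stochastic_process M Z \<and>
     (\<forall>s. equal_in_law M (\<lambda>t \<omega>. Z t \<omega> - Z 0 \<omega>) (\<lambda>t \<omega>. Z (t + s) \<omega> - Z s \<omega>))"

definition finite_moments :: "'a measure \<Rightarrow> real \<Rightarrow> (real \<Rightarrow> 'a \<Rightarrow> real) \<Rightarrow> bool" where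
  "finite_moments M p Z \<longleftrightarrow> (\<forall>t. integrable M (\<lambda>\<omega>. \<bar>Z t \<omega>\<bar> powr p))"

definition Lp_norm :: "'a measure \<Rightarrow> real \<Rightarrow> ('a \<Rightarrow> real) \<Rightarrow> real" where
  "Lp_norm M p f = (\<integral>\<omega>. \<bar>f \<omega>\<bar> powr p \<partial>M) powr (1 / p)"

text \<open>Continuity of \<open>t \<mapsto> Z t\<close> with respect to the norm of \<open>L\<^sup>p\<close>. It is only meaningful together
  with \<open>finite_moments M p Z\<close>, since the integral of a non-integrable function is 0.\<close>

definition continuous_in_Lp :: "'a measure \<Rightarrow> real \<Rightarrow> (real \<Rightarrow> 'a \<Rightarrow> real) \<Rightarrow> bool" where
  "continuous_in_Lp M p Z \<longleftrightarrow>
     (\<forall>t. ((\<lambda>s. Lp_norm M p (\<lambda>\<omega>. Z s \<omega> - Z t \<omega>)) \<longlongrightarrow> 0) (at t))"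

text \<open>The equation is pathwise: outside one null set it holds for all times simultaneously.
  Joint measurability of \<open>X\<close> is not demanded; if \<open>N\<close> is measurable, it follows (up to a null set)
  from the equation, because \<open>X - N\<close> then has continuous paths. For the same reason integrability
  with respect to \<open>lborel\<close> is no restriction compared with \<open>lebesgue\<close>. The interval integral
  changes sign when its bounds are swapped.\<close>

definition QOU_process ::
    "'a measure \<Rightarrow> (real \<Rightarrow> 'a \<Rightarrow> real) \<Rightarrow> real \<Rightarrow> (real \<Rightarrow> 'a \<Rightarrow> real) \<Rightarrow> bool" where
  "QOU_process M N l X \<longleftrightarrow>
     stationary_process M X \<and>
     (AE \<omega> in M. \<forall>t.
        interval_lebesgue_integrable lborel (ereal 0) (ereal t) (\<lambda>s. X s \<omega>) \<and>
        X t \<omega> = X 0 \<omega> - l * (LBINT s=ereal 0..ereal t. X s \<omega>) + (N t \<omega> - N 0 \<omega>))"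

end

theory Submission
  imports Defs
begin

text \<open>Let \<open>\<psi> h\<close> be the \<open>p\<close>-th absolute moment of \<open>N h - N 0\<close>; by stationarity it is also that of
  \<open>N (t + h) - N t\<close>. Joint measurability makes \<open>\<psi>\<close> measurable and, by Fubini and continuity of
  translation in \<open>L\<^sup>p\<close>, continuous at 0; quasi-subadditivity gives local boundedness and
  polynomial growth. The substitution \<open>s = t - u\<close> turns the definition of \<open>X\<close> into
  \<open>X t = N t - E N (t - U)\<close> with \<open>U\<close> exponentially distributed and independent of \<open>N\<close>, so Jensen's
  inequality bounds the moments of \<open>X t\<close>, and those of \<open>X s - X t\<close> by a multiple of \<open>\<psi> (s - t)\<close>.
  Discretising \<open>U\<close> approximates \<open>X\<close> by finite combinations of increments of \<open>N\<close>, hence \<open>X\<close> is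
  stationary. Two solutions of the Langevin equation differ by \<open>exp (- l * t)\<close> times their
  difference at 0; two stationary ones therefore have the same law, as is seen by letting
  \<open>t \<rightarrow> \<infinity>\<close>.\<close>

subsection \<open>Convexity and growth of powers\<close>

text \<open>The obstacle is that paths of \<open>N\<close> are merely measurable: local boundedness
  of the moment function has to come from a measure argument, and the Langevin equation for
  \<open>X\<close> cannot be checked by differentiating an integral pathwise. Only the increments of
  \<open>N\<close> have shift-invariant laws, not \<open>N\<close> itself. The formula for
  \<open>X\<close> can be written with increments alone because \<open>l * exp (- l * u)\<close> is
  a probability density on the half line, so \<open>N t\<close> is its own average. Polynomial
  growth is used in the form of an exponential bound of arbitrarily small rate. The rate
  \<open>l / 2\<close> keeps delayed moments integrable against the density of rate
  \<open>l\<close>; the rate \<open>l / 6\<close> does the same when time differences are as large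
  as \<open>3 * \<bar>u\<bar>\<close>. Laws are compared through products of Lipschitz functions,
  since closeness in probability does not give closeness of distribution functions at every point.
  Distances are truncated by \<open>min 1\<close> because a competing solution comes without
  moments.\<close>

lemma powr_abs_convex:
  fixes p :: real
  assumes "1 \<le> p"
  shows "convex_on UNIV (\<lambda>x. \<bar>x\<bar> powr p)"
proof (rule convex_onI)
  fix t x y :: real
  assume t: "0 < t" "t < 1"
  have pos: "((1 - t) * a + t * b) powr p \<le> (1 - t) * a powr p + t * b powr p"
    if ab: "0 \<le> a" "0 \<le> b" for a b :: real
  proof -
    \<comment> \<open>This settles the boundary cases: if \<open>a\<close> or \<open>b\<close>
      vanishes, the inequality reduces to \<open>c powr p \<le> c\<close> for \<open>c\<close>
      between 0 and 1.\<close>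
    have scale: "(c * d) powr p \<le> c * d powr p" if "0 < c" "c < 1" "0 \<le> d" for c d :: real
    proof -
      have "c powr p \<le> c powr 1"
        using that assms by (intro powr_mono') auto
      then show ?thesis
        using that by (simp add: powr_mult mult_right_mono)
    qed
    consider "a = 0" | "b = 0" | "0 < a" "0 < b" using ab by fastforce
    then show ?thesis
    proof cases
      case 1 then show ?thesis using scale[of t b] t ab by simp
    next
      case 2 then show ?thesis using scale[of "1 - t" a] t ab by simp
    next
      case 3
      then show ?thesis
        using convex_onD[OF powr_convex[OF assms], of t a b] t by simp
    qed
  qed
  have "\<bar>(1 - t) *\<^sub>R x + t *\<^sub>R y\<bar> \<le> (1 - t) * \<bar>x\<bar> + t * \<bar>y\<bar>"
    using abs_triangle_ineq[of "(1 - t) * x" "t * y"] t by (simp add: abs_mult)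
  then have "\<bar>(1 - t) *\<^sub>R x + t *\<^sub>R y\<bar> powr p \<le> ((1 - t) * \<bar>x\<bar> + t * \<bar>y\<bar>) powr p"
    using assms by (intro powr_mono2) auto
  also have "\<dots> \<le> (1 - t) * \<bar>x\<bar> powr p + t * \<bar>y\<bar> powr p"
    by (intro pos) auto
  finally show "\<bar>(1 - t) *\<^sub>R x + t *\<^sub>R y\<bar> powr p \<le> (1 - t) * \<bar>x\<bar> powr p + t * \<bar>y\<bar> powr p" .
qed simp

text \<open>Convexity with equal weights \<open>1 / n\<close>, multiplied by
  \<open>n powr p\<close>. With the exponent \<open>p - 1\<close>, a sum of \<open>n\<close> terms
  of equal moment costs exactly \<open>n powr p\<close>.\<close>

lemma powr_abs_sum_le:
  fixes p :: real and x :: "nat \<Rightarrow> real"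
  assumes "1 \<le> p" "0 < n"
  shows "\<bar>\<Sum>i<n. x i\<bar> powr p \<le> real n powr (p - 1) * (\<Sum>i<n. \<bar>x i\<bar> powr p)"
proof -
  have "\<bar>\<Sum>i<n. (1 / n) *\<^sub>R x i\<bar> powr p \<le> (\<Sum>i<n. (1 / n) * \<bar>x i\<bar> powr p)"
    using assms by (intro convex_on_sum[OF _ _ powr_abs_convex]) auto
  then have "(\<bar>\<Sum>i<n. x i\<bar> / n) powr p \<le> (\<Sum>i<n. \<bar>x i\<bar> powr p) / n"
    by (simp flip: sum_divide_distrib)
  then have "\<bar>\<Sum>i<n. x i\<bar> powr p \<le> n powr p * ((\<Sum>i<n. \<bar>x i\<bar> powr p) / n)"
    using assms by (simp add: powr_divide field_simps)
  also have "\<dots> = real n powr (p - 1) * (\<Sum>i<n. \<bar>x i\<bar> powr p)"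
    using assms by (simp add: powr_diff)
  finally show ?thesis .
qed

lemma powr_abs_add_le:
  fixes a b p :: real
  assumes "1 \<le> p"
  shows "\<bar>a + b\<bar> powr p \<le> 2 powr p * (\<bar>a\<bar> powr p + \<bar>b\<bar> powr p)"
proof -
  have "\<bar>a + b\<bar> powr p \<le> 2 powr (p - 1) * (\<bar>a\<bar> powr p + \<bar>b\<bar> powr p)"
    using powr_abs_sum_le[OF assms, of 2 "\<lambda>i. if i = 0 then a else b"]
    by (simp add: numeral_2_eq_2)
  also have "\<dots> \<le> 2 powr p * (\<bar>a\<bar> powr p + \<bar>b\<bar> powr p)"
    by (intro mult_right_mono powr_mono) auto
  finally show ?thesis .
qed

lemma powr_abs_diff_le:
  fixes a b p :: real
  assumes "1 \<le> p"
  shows "\<bar>a - b\<bar> powr p \<le> 2 powr p * (\<bar>a\<bar> powr p + \<bar>b\<bar> powr p)"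
  using powr_abs_add_le[OF assms, of a "- b"] by simp

text \<open>Where the total mass is finite this embeds \<open>L^p\<close> into \<open>L^1\<close>;
  it is applied both on the probability space and on a bounded time window.\<close>

lemma abs_le_1_plus_powr:
  fixes x p :: real
  assumes "1 \<le> p"
  shows "\<bar>x\<bar> \<le> 1 + \<bar>x\<bar> powr p"
proof (cases "\<bar>x\<bar> \<le> 1")
  case False
  then show ?thesis using powr_mono[OF assms, of "\<bar>x\<bar>"] by simp
qed (simp add: add_increasing2)

text \<open>Raise \<open>y \<le> exp y\<close> at \<open>y = (c / p) * (1 + x)\<close> to the power
  \<open>p\<close>. The rate \<open>c\<close> may be as small as desired, at the price of a larger
  constant.\<close>

lemma powr_le_exp:
  fixes c p x :: real
  assumes "0 < c" "0 < p" "0 \<le> x"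
  shows "(1 + x) powr p \<le> ((p / c) powr p * exp c) * exp (c * x)"
proof -
  have "(c / p) * (1 + x) \<le> exp ((c / p) * (1 + x))"
    using exp_ge_add_one_self[of "(c / p) * (1 + x)"] by linarith
  then have "1 + x \<le> (p / c) * exp ((c / p) * (1 + x))"
    using assms by (simp add: field_simps)
  then have "(1 + x) powr p \<le> ((p / c) * exp ((c / p) * (1 + x))) powr p"
    using assms by (intro powr_mono2) auto
  also have "\<dots> = (p / c) powr p * exp (c * (1 + x))"
    using assms powr_mult[of "p / c" "exp ((c / p) * (1 + x))" p] by (simp add: exp_powr_real)
  also have "\<dots> = ((p / c) powr p * exp c) * exp (c * x)"
    by (simp add: distrib_left exp_add)
  finally show ?thesis .
qed

subsection \<open>Continuity of translation in Lebesgue spaces\<close>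

text \<open>A point of an open set stays in it under small shifts, so the positive part of
  \<open>?u x - ?u (x + h n)\<close> tends to 0, dominated by the indicator of \<open>U\<close>. A
  shift preserves total mass, hence the negative part has the same integral and the full distance is
  twice the positive part.\<close>

lemma translation_L1_open:
  fixes h :: "nat \<Rightarrow> real"
  assumes U: "open U" "emeasure lborel U < \<infinity>" and h: "h \<longlonglongrightarrow> 0"
  shows "(\<lambda>n. \<integral>x. \<bar>indicator U (x + h n) - indicator U x :: real\<bar> \<partial>lborel) \<longlonglongrightarrow> 0"
proof -
  let ?u = "indicator U :: real \<Rightarrow> real"
  have meas[measurable]: "U \<in> sets borel" using U by auto
  have u: "integrable lborel ?u" using U by (simp add: integrable_indicator_iff)
  have us: "integrable lborel (\<lambda>x. ?u (x + c))" for c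
    using lborel_integrable_real_affine[OF u, of 1 c] by (simp add: add.commute)
  have eq: "(\<integral>x. ?u (x + c) \<partial>lborel) = (\<integral>x. ?u x \<partial>lborel)" for c
    using lborel_integral_real_affine[of 1 ?u c] by (simp add: add.commute)
  have "(\<lambda>n. \<integral>x. max 0 (?u x - ?u (x + h n)) \<partial>lborel) \<longlonglongrightarrow> (\<integral>x. 0 \<partial>(lborel :: real measure))"
  proof (rule integral_dominated_convergence[where w = "indicator U"])
    show "AE x in lborel. (\<lambda>n. max 0 (?u x - ?u (x + h n))) \<longlonglongrightarrow> 0"
    proof (rule AE_I2)
      fix x
      show "(\<lambda>n. max 0 (?u x - ?u (x + h n))) \<longlonglongrightarrow> 0"
      proof (cases "x \<in> U")
        case True
        have "(\<lambda>n. x + h n) \<longlonglongrightarrow> x" using tendsto_add[OF tendsto_const h, of x] by simp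
        then have "\<forall>\<^sub>F n in sequentially. x + h n \<in> U"
          using U True by (simp add: topological_tendstoD)
        then have "\<forall>\<^sub>F n in sequentially. max 0 (?u x - ?u (x + h n)) = 0"
          by eventually_elim (use True in simp)
        then show ?thesis by (rule tendsto_eventually)
      qed simp
    qed
  qed (auto simp: u indicator_def)
  then have "(\<lambda>n. 2 * (\<integral>x. max 0 (?u x - ?u (x + h n)) \<partial>lborel)) \<longlonglongrightarrow> 0"
    by (simp add: tendsto_mult_right_zero)
  moreover have "(\<integral>x. \<bar>?u (x + c) - ?u x\<bar> \<partial>lborel) = 2 * (\<integral>x. max 0 (?u x - ?u (x + c)) \<partial>lborel)" for c
  proof -
    have "(\<integral>x. \<bar>?u (x + c) - ?u x\<bar> \<partial>lborel)
        = (\<integral>x. 2 * max 0 (?u x - ?u (x + c)) + (?u (x + c) - ?u x) \<partial>lborel)"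
      by (intro Bochner_Integration.integral_cong) (auto simp: max_def)
    also have "\<dots> = (\<integral>x. 2 * max 0 (?u x - ?u (x + c)) \<partial>lborel) + (\<integral>x. ?u (x + c) - ?u x \<partial>lborel)"
      using u us[of c] by (intro Bochner_Integration.integral_add) auto
    also have "(\<integral>x. ?u (x + c) - ?u x \<partial>lborel) = 0"
      using u us[of c] eq[of c] by (subst Bochner_Integration.integral_diff) auto
    finally show ?thesis by simp
  qed
  ultimately show ?thesis by simp
qed

text \<open>Three-epsilon argument: translation is an isometry of \<open>L^1\<close>, so the set of
  functions with the asserted property is closed.\<close>

lemma translation_L1_closed:
  fixes f :: "real \<Rightarrow> real" and h :: "nat \<Rightarrow> real"
  assumes f: "integrable lborel f"
    and approx: "\<And>e. 0 < e \<Longrightarrow> \<exists>g. integrable lborel g \<and> (\<integral>x. \<bar>f x - g x\<bar> \<partial>lborel) < e \<and>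
      (\<lambda>n. \<integral>x. \<bar>g (x + h n) - g x\<bar> \<partial>lborel) \<longlonglongrightarrow> 0"
  shows "(\<lambda>n. \<integral>x. \<bar>f (x + h n) - f x\<bar> \<partial>lborel) \<longlonglongrightarrow> 0"
proof (rule LIMSEQ_I)
  fix e :: real assume e: "0 < e"
  obtain g where g: "integrable lborel g" and fg: "(\<integral>x. \<bar>f x - g x\<bar> \<partial>lborel) < e / 3"
    and lim: "(\<lambda>n. \<integral>x. \<bar>g (x + h n) - g x\<bar> \<partial>lborel) \<longlonglongrightarrow> 0"
    using approx[of "e / 3"] e by auto
  have shift: "integrable lborel (\<lambda>x. k (x + c))" if "integrable lborel k" for k :: "real \<Rightarrow> real" and c
    using lborel_integrable_real_affine[OF that, of 1 c] by (simp add: add.commute)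
  have eq: "(\<integral>x. \<bar>f (x + c) - g (x + c)\<bar> \<partial>lborel) = (\<integral>x. \<bar>f x - g x\<bar> \<partial>lborel)" for c
    using lborel_integral_real_affine[of 1 "\<lambda>x. \<bar>f x - g x\<bar>" c] by (simp add: add.commute)
  have bound: "(\<integral>x. \<bar>f (x + c) - f x\<bar> \<partial>lborel)
      \<le> 2 * (\<integral>x. \<bar>f x - g x\<bar> \<partial>lborel) + (\<integral>x. \<bar>g (x + c) - g x\<bar> \<partial>lborel)" for c
  proof -
    note [simp] = f g shift[OF f] shift[OF g]
    have "(\<integral>x. \<bar>f (x + c) - f x\<bar> \<partial>lborel)
      \<le> (\<integral>x. \<bar>f (x + c) - g (x + c)\<bar> + \<bar>f x - g x\<bar> + \<bar>g (x + c) - g x\<bar> \<partial>lborel)"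
      by (intro integral_mono) auto
    also have "\<dots> = (\<integral>x. \<bar>f (x + c) - g (x + c)\<bar> \<partial>lborel) + (\<integral>x. \<bar>f x - g x\<bar> \<partial>lborel)
        + (\<integral>x. \<bar>g (x + c) - g x\<bar> \<partial>lborel)"
      by simp
    finally show ?thesis using eq by simp
  qed
  obtain n0 where n0: "\<And>n. n \<ge> n0 \<Longrightarrow> \<bar>\<integral>x. \<bar>g (x + h n) - g x\<bar> \<partial>lborel\<bar> < e / 3"
    using LIMSEQ_D[OF lim, of "e / 3"] e by auto
  show "\<exists>no. \<forall>n\<ge>no. norm ((\<integral>x. \<bar>f (x + h n) - f x\<bar> \<partial>lborel) - 0) < e"
  proof (intro exI allI impI)
    fix n assume "n \<ge> n0"
    then show "norm ((\<integral>x. \<bar>f (x + h n) - f x\<bar> \<partial>lborel) - 0) < e"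
      using bound[of "h n"] fg n0[of n] by auto
  qed
qed

text \<open>Outer regularity approximates an indicator by indicators of open sets; the triangle
  inequality handles sums, and closedness handles dominated limits.\<close>

lemma translation_L1_tendsto:
  fixes f :: "real \<Rightarrow> real" and h :: "nat \<Rightarrow> real"
  assumes "integrable lborel f" and h: "h \<longlonglongrightarrow> 0"
  shows "(\<lambda>n. \<integral>x. \<bar>f (x + h n) - f x\<bar> \<partial>lborel) \<longlonglongrightarrow> 0"
  using assms(1)
proof (induction f rule: integrable_induct)
  case (base A c)
  then have [measurable]: "A \<in> sets borel" by simp
  show ?case
  proof (rule translation_L1_closed)
    show "integrable lborel (\<lambda>x. indicat_real A x *\<^sub>R c)"
      using base by (auto simp: integrable_indicator_iff)
    fix e :: real assume e: "0 < e"
    define d where "d = e / (\<bar>c\<bar> + 1)"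
    have d: "0 < d" "d * \<bar>c\<bar> < e" using e by (auto simp: d_def field_simps)
    obtain U where U: "open U" "A \<subseteq> U" "emeasure lborel (U - A) < d"
      using outer_regular_lborel[OF _ d(1), of A] by auto
    have [measurable]: "U \<in> sets borel" using U by auto
    have "emeasure lborel U \<le> emeasure lborel A + emeasure lborel (U - A)"
      using U(2) by (subst plus_emeasure) (auto simp: Un_absorb1 Un_commute)
    also have "\<dots> < \<infinity>"
      using base U(3) by (auto simp: less_top[symmetric])
    finally have Uf: "emeasure lborel U < \<infinity>" .
    have md: "measure lborel (U - A) < d"
      using U(3) d(1) emeasure_eq_ennreal_measure[of lborel "U - A"]
      by (metis ennreal_less_iff measure_nonneg order_less_imp_not_less top_greatest leD)
    show "\<exists>g. integrable lborel g \<and> (\<integral>x. \<bar>indicat_real A x *\<^sub>R c - g x\<bar> \<partial>lborel) < e \<and>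
      (\<lambda>n. \<integral>x. \<bar>g (x + h n) - g x\<bar> \<partial>lborel) \<longlonglongrightarrow> 0"
    proof (intro exI[of _ "\<lambda>x. c * indicator U x"] conjI)
      show "integrable lborel (\<lambda>x. c * indicat_real U x)"
        using Uf by (auto simp: integrable_indicator_iff)
      have "(\<integral>x. \<bar>indicat_real A x *\<^sub>R c - c * indicat_real U x\<bar> \<partial>lborel)
          = (\<integral>x. \<bar>c\<bar> * indicat_real (U - A) x \<partial>lborel)"
        using U(2) by (intro Bochner_Integration.integral_cong) (auto simp: indicator_def)
      also have "\<dots> = \<bar>c\<bar> * measure lborel (U - A)"
        by simp
      also have "\<dots> \<le> \<bar>c\<bar> * d" using md by (intro mult_left_mono) auto
      finally show "(\<integral>x. \<bar>indicat_real A x *\<^sub>R c - c * indicat_real U x\<bar> \<partial>lborel) < e"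
        using d by (simp add: mult.commute)
      have "(\<lambda>n. \<bar>c\<bar> * (\<integral>x. \<bar>indicator U (x + h n) - indicator U x :: real\<bar> \<partial>lborel)) \<longlonglongrightarrow> 0"
        using translation_L1_open[OF U(1) Uf h] by (simp add: tendsto_mult_right_zero)
      moreover have "\<bar>c * indicator U (x + k) - c * indicator U x\<bar>
          = \<bar>c\<bar> * \<bar>indicator U (x + k) - indicator U x :: real\<bar>" for x k
        by (simp flip: right_diff_distrib abs_mult)
      ultimately show "(\<lambda>n. \<integral>x. \<bar>c * indicator U (x + h n) - c * indicator U x\<bar> \<partial>lborel) \<longlonglongrightarrow> 0"
        by simp
    qed
  qed
next
  case (add f g)
  have shift: "integrable lborel (\<lambda>x. k (x + c))" if "integrable lborel k" for k :: "real \<Rightarrow> real" and c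
    using lborel_integrable_real_affine[OF that, of 1 c] by (simp add: add.commute)
  note [simp] = add.hyps shift[OF add.hyps(1)] shift[OF add.hyps(2)]
  show ?case
  proof (rule tendsto_sandwich[OF _ _ tendsto_const])
    show "(\<lambda>n. (\<integral>x. \<bar>f (x + h n) - f x\<bar> \<partial>lborel) + (\<integral>x. \<bar>g (x + h n) - g x\<bar> \<partial>lborel)) \<longlonglongrightarrow> 0"
      using tendsto_add[OF add.IH] by simp
    have "(\<integral>x. \<bar>f (x + c) + g (x + c) - (f x + g x)\<bar> \<partial>lborel)
      \<le> (\<integral>x. \<bar>f (x + c) - f x\<bar> + \<bar>g (x + c) - g x\<bar> \<partial>lborel)" for c
      by (intro integral_mono) auto
    then show "\<forall>\<^sub>F n in sequentially. (\<integral>x. \<bar>f (x + h n) + g (x + h n) - (f x + g x)\<bar> \<partial>lborel)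
      \<le> (\<integral>x. \<bar>f (x + h n) - f x\<bar> \<partial>lborel) + (\<integral>x. \<bar>g (x + h n) - g x\<bar> \<partial>lborel)"
      by simp
  qed simp
next
  case (lim f s)
  show ?case
  proof (rule translation_L1_closed[OF lim.hyps(4)])
    fix e :: real assume e: "0 < e"
    have "(\<lambda>i. \<integral>x. \<bar>f x - s i x\<bar> \<partial>lborel) \<longlonglongrightarrow> (\<integral>x. 0 \<partial>(lborel :: real measure))"
    \<comment> \<open>The approximants of the induction rule satisfy
      \<open>\<bar>s i x\<bar> \<le> 2 * \<bar>f x\<bar>\<close>, whence the factor 3.\<close>
    proof (rule integral_dominated_convergence[where w = "\<lambda>x. 3 * \<bar>f x\<bar>"])
      show "AE x in lborel. (\<lambda>i. \<bar>f x - s i x\<bar>) \<longlonglongrightarrow> 0"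
      proof (rule AE_I2)
        fix x
        show "(\<lambda>i. \<bar>f x - s i x\<bar>) \<longlonglongrightarrow> 0"
          using tendsto_rabs[OF tendsto_diff[OF tendsto_const[of "f x"] lim.hyps(2)[of x]]] by simp
      qed
      show "AE x in lborel. norm \<bar>f x - s i x\<bar> \<le> 3 * \<bar>f x\<bar>" for i
      proof (rule AE_I2)
        fix x
        show "norm \<bar>f x - s i x\<bar> \<le> 3 * \<bar>f x\<bar>" using lim.hyps(3)[of x i] by simp
      qed
      show "(\<lambda>x. \<bar>f x - s i x\<bar>) \<in> borel_measurable lborel" for i
        using lim.hyps(1)[of i] lim.hyps(4) by (intro borel_measurable_abs borel_measurable_diff) auto
    qed (use lim.hyps(4) in auto)
    then obtain i where "(\<integral>x. \<bar>f x - s i x\<bar> \<partial>lborel) < e"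
      using order_tendstoD(2)[of _ "\<integral>x. 0 \<partial>(lborel :: real measure)" sequentially e] e
      by (auto simp: eventually_sequentially)
    then show "\<exists>g. integrable lborel g \<and> (\<integral>x. \<bar>f x - g x\<bar> \<partial>lborel) < e \<and>
      (\<lambda>n. \<integral>x. \<bar>g (x + h n) - g x\<bar> \<partial>lborel) \<longlonglongrightarrow> 0"
      using lim.hyps(1) lim.IH by blast
  qed
qed


text \<open>Clip \<open>f\<close> to \<open>[-k, k]\<close>. The clipping error is small in
  \<open>L^p\<close> by dominated convergence. For the clipped function, a difference bounded by
  \<open>2 * k\<close> satisfies \<open>\<bar>d\<bar> powr p \<le> (2 * k) powr (p - 1) *
  \<bar>d\<bar>\<close>, which reduces the claim to \<open>L^1\<close>.\<close>

lemma translation_Lp_tendsto: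
  fixes f :: "real \<Rightarrow> real" and h :: "nat \<Rightarrow> real"
  assumes p: "1 \<le> p" and f: "integrable lborel f" "integrable lborel (\<lambda>x. \<bar>f x\<bar> powr p)"
    and h: "h \<longlonglongrightarrow> 0"
  shows "(\<lambda>n. \<integral>x. \<bar>f (x + h n) - f x\<bar> powr p \<partial>lborel) \<longlonglongrightarrow> 0"
proof -
  define g where "g k x = max (- real k) (min (real k) (f x))" for k x
  define C where "C = 2 powr p * 2 powr p"
  have C: "0 < C" by (simp add: C_def)
  have [measurable]: "f \<in> borel_measurable borel" using f(1) by simp
  have [measurable]: "g k \<in> borel_measurable borel" for k unfolding g_def by simp
  have shift: "integrable lborel (\<lambda>x. k (x + c))" if "integrable lborel k" for k :: "real \<Rightarrow> real" and c
    using lborel_integrable_real_affine[OF that, of 1 c] by (simp add: add.commute)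
  have fg_le: "\<bar>f x - g k x\<bar> \<le> \<bar>f x\<bar>" for k x
    by (auto simp: g_def)
  have fg_powr_le: "\<bar>f x - g k x\<bar> powr p \<le> \<bar>f x\<bar> powr p" for k x
    using fg_le p by (intro powr_mono2) auto
  have fg_int: "integrable lborel (\<lambda>x. \<bar>f x - g k x\<bar> powr p)" for k
    using fg_powr_le by (intro Bochner_Integration.integrable_bound[OF f(2)]) auto
  have lim_fg: "(\<lambda>k. \<integral>x. \<bar>f x - g k x\<bar> powr p \<partial>lborel) \<longlonglongrightarrow> (\<integral>x. 0 \<partial>(lborel :: real measure))"
  proof (rule integral_dominated_convergence[where w = "\<lambda>x. \<bar>f x\<bar> powr p"])
    show "AE x in lborel. (\<lambda>k. \<bar>f x - g k x\<bar> powr p) \<longlonglongrightarrow> 0"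
    proof (rule AE_I2, rule tendsto_eventually)
      fix x
      obtain K :: nat where "\<bar>f x\<bar> \<le> real K" using real_arch_simple by blast
      then have "\<forall>k\<ge>K. \<bar>f x - g k x\<bar> powr p = 0" by (auto simp: g_def)
      then show "\<forall>\<^sub>F k in sequentially. \<bar>f x - g k x\<bar> powr p = 0"
        unfolding eventually_sequentially by blast
    qed
  qed (use f fg_powr_le in auto)
  have bound: "(\<integral>x. \<bar>f (x + c) - f x\<bar> powr p \<partial>lborel)
      \<le> C * (2 * (\<integral>x. \<bar>f x - g k x\<bar> powr p \<partial>lborel)
        + (2 * real k) powr (p - 1) * (\<integral>x. \<bar>f (x + c) - f x\<bar> \<partial>lborel))" for c k
  proof -
    note [simp] = f(1) shift[OF f(1)] fg_int shift[OF fg_int]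
    have pw: "\<bar>f (x + c) - f x\<bar> powr p \<le> C * ((\<bar>f (x + c) - g k (x + c)\<bar> powr p + \<bar>f x - g k x\<bar> powr p)
        + (2 * real k) powr (p - 1) * \<bar>f (x + c) - f x\<bar>)" (is "?l \<le> C * (?a + ?b + ?c)") for x
    proof -
      let ?A = "f (x + c) - g k (x + c)" and ?B = "f x - g k x" and ?G = "g k (x + c) - g k x"
      have "?l = \<bar>(?A - ?B) + ?G\<bar> powr p" by (simp add: algebra_simps)
      also have "\<dots> \<le> 2 powr p * (\<bar>?A - ?B\<bar> powr p + \<bar>?G\<bar> powr p)"
        by (rule powr_abs_add_le[OF p])
      also have "\<dots> \<le> 2 powr p * (2 powr p * (?a + ?b) + 2 powr p * ?c)"
      proof (intro mult_left_mono add_mono)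
        show "\<bar>?A - ?B\<bar> powr p \<le> 2 powr p * (?a + ?b)"
          by (rule powr_abs_diff_le[OF p])
        \<comment> \<open>Clipping is 1-Lipschitz, so the last factor is at most the unclipped
          difference \<open>\<bar>f (x + c) - f x\<bar>\<close>.\<close>
        have "\<bar>?G\<bar> powr p = \<bar>?G\<bar> powr (p - 1) * \<bar>?G\<bar>"
          by (cases "?G = 0") (auto simp: powr_diff)
        also have "\<dots> \<le> ?c"
          using p by (intro mult_mono powr_mono2) (auto simp: g_def)
        also have "\<dots> \<le> 2 powr p * ?c"
          using p ge_one_powr_ge_zero[of 2 p] mult_right_mono[of 1 "2 powr p" ?c] by simp
        finally show "\<bar>?G\<bar> powr p \<le> 2 powr p * ?c" .
      qed auto
      finally show ?thesis by (simp add: C_def algebra_simps)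
    qed
    have "(\<integral>x. \<bar>f (x + c) - f x\<bar> powr p \<partial>lborel) \<le>
      (\<integral>x. C * ((\<bar>f (x + c) - g k (x + c)\<bar> powr p + \<bar>f x - g k x\<bar> powr p)
        + (2 * real k) powr (p - 1) * \<bar>f (x + c) - f x\<bar>) \<partial>lborel)"
      by (intro Bochner_Integration.integral_mono'[OF _ pw] order_trans[OF powr_ge_zero pw]) simp
    also have "\<dots> = C * ((\<integral>x. \<bar>f (x + c) - g k (x + c)\<bar> powr p \<partial>lborel)
        + (\<integral>x. \<bar>f x - g k x\<bar> powr p \<partial>lborel)
        + (2 * real k) powr (p - 1) * (\<integral>x. \<bar>f (x + c) - f x\<bar> \<partial>lborel))"
      by simp
    also have "(\<integral>x. \<bar>f (x + c) - g k (x + c)\<bar> powr p \<partial>lborel) = (\<integral>x. \<bar>f x - g k x\<bar> powr p \<partial>lborel)"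
      using lborel_integral_real_affine[of 1 "\<lambda>x. \<bar>f x - g k x\<bar> powr p" c] by (simp add: add.commute)
    finally show ?thesis by (simp add: algebra_simps)
  qed
  show ?thesis
  proof (rule LIMSEQ_I)
    fix e :: real assume e: "0 < e"
    obtain k where k: "(\<integral>x. \<bar>f x - g k x\<bar> powr p \<partial>lborel) < e / (4 * C)"
      using order_tendstoD(2)[OF lim_fg, of "e / (4 * C)"] e C by (auto simp: eventually_sequentially)
    define D where "D = (2 * real k) powr (p - 1)"
    have "(\<lambda>n. C * (D * (\<integral>x. \<bar>f (x + h n) - f x\<bar> \<partial>lborel))) \<longlonglongrightarrow> C * (D * 0)"
      by (intro tendsto_mult tendsto_const translation_L1_tendsto f h)
    then obtain n0 where n0: "\<And>n. n \<ge> n0 \<Longrightarrow> C * (D * (\<integral>x. \<bar>f (x + h n) - f x\<bar> \<partial>lborel)) < e / 2"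
      using order_tendstoD(2)[of _ "C * (D * 0)" sequentially "e / 2"] e
      by (auto simp: eventually_sequentially)
    have *: "C * (2 * (\<integral>x. \<bar>f x - g k x\<bar> powr p \<partial>lborel)) < e / 2"
      using k C e by (simp add: field_simps)
    show "\<exists>no. \<forall>n\<ge>no. norm ((\<integral>x. \<bar>f (x + h n) - f x\<bar> powr p \<partial>lborel) - 0) < e"
    proof (intro exI allI impI)
      fix n assume "n \<ge> n0"
      then show "norm ((\<integral>x. \<bar>f (x + h n) - f x\<bar> powr p \<partial>lborel) - 0) < e"
        using bound[of "h n" k] n0[of n] * by (simp add: D_def distrib_left)
    qed
  qed
qed

subsection \<open>Laws of finite families via test functions\<close>

text \<open>A Lipschitz ramp: 1 for \<open>x \<le> 0\<close>, 0 for \<open>x \<ge> 1 / m\<close>,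
  linear between (constantly 1 for \<open>m = 0\<close>). As \<open>m\<close> grows it decreases to
  the indicator of the nonpositive numbers.\<close>

definition soft_le :: "nat \<Rightarrow> real \<Rightarrow> real" where
  "soft_le m x = max 0 (min 1 (1 - real m * x))"

lemma soft_le_measurable [measurable]: "soft_le m \<in> borel_measurable borel"
  unfolding soft_le_def by simp

lemma soft_le_bounds: "0 \<le> soft_le m x" "soft_le m x \<le> 1"
  by (auto simp: soft_le_def)

text \<open>Truncating the distance at 1 makes convergence in probability sufficient. The constant
  is \<open>max 1 m\<close> because the trivial bound 1 on the difference must also be
  covered.\<close>

lemma soft_le_lipschitz: "\<bar>soft_le m x - soft_le m y\<bar> \<le> max 1 (real m) * min 1 \<bar>x - y\<bar>"
proof -
  have "\<bar>soft_le m x - soft_le m y\<bar> \<le> \<bar>real m * x - real m * y\<bar>"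
    by (auto simp: soft_le_def)
  also have "\<dots> = real m * \<bar>x - y\<bar>"
    by (simp flip: right_diff_distrib add: abs_mult)
  also have "\<dots> \<le> max 1 (real m) * \<bar>x - y\<bar>"
    by (intro mult_right_mono) auto
  finally have "\<bar>soft_le m x - soft_le m y\<bar> \<le> max 1 (real m) * \<bar>x - y\<bar>" .
  moreover have "\<bar>soft_le m x - soft_le m y\<bar> \<le> max 1 (real m) * 1"
    using soft_le_bounds[of m x] soft_le_bounds[of m y] by linarith
  ultimately show ?thesis by (auto simp: min_def)
qed

lemma soft_le_tendsto: "(\<lambda>m. soft_le m x) \<longlonglongrightarrow> (if x \<le> 0 then 1 else 0)"
proof (cases "x \<le> 0")
  case True
  then have "soft_le m x = 1" for m
    by (auto simp: soft_le_def mult_nonneg_nonpos)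
  then show ?thesis using True by simp
next
  case False
  obtain m0 :: nat where m0: "1 / x \<le> real m0" using real_arch_simple by blast
  have "soft_le m x = 0" if "m \<ge> m0" for m
  proof -
    have "1 / x \<le> real m" using m0 that by linarith
    then show ?thesis using False by (auto simp: soft_le_def field_simps)
  qed
  then have "\<forall>\<^sub>F m in sequentially. soft_le m x = 0"
    by (auto simp: eventually_sequentially)
  then show ?thesis using False by (simp add: tendsto_eventually)
qed

text \<open>A finite measure on a finite product is determined by its joint distribution function:
  the lower orthants are stable under intersection, generate the product sigma-algebra and exhaust
  the space.\<close>

lemma measure_eqI_PiM_atMost:
  fixes P Q :: "('i \<Rightarrow> real) measure"
  assumes J: "finite J" and sets: "sets P = sets (\<Pi>\<^sub>M i\<in>J. borel)" "sets Q = sets (\<Pi>\<^sub>M i\<in>J. borel)"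
    and fin: "finite_measure P"
    and eq: "\<And>a. emeasure P (\<Pi>\<^sub>E i\<in>J. {..a i}) = emeasure Q (\<Pi>\<^sub>E i\<in>J. {..a i})"
  shows "P = Q"
proof -
  \<comment> \<open>This set-builder shape is the one expected by \<open>sets_PiM_sigma\<close>,
    with \<open>J\<close> as the only block of indices; \<open>box\<close> then identifies the
    members as orthants.\<close>
  define E where "E = {{f\<in>(\<Pi>\<^sub>E i\<in>J. UNIV). \<forall>i\<in>j. f i \<in> A i} | A j. j \<in> {J} \<and> A \<in> Pi j (\<lambda>_. range (\<lambda>a::real. {..a}))}"
  have box: "X \<in> E \<longleftrightarrow> (\<exists>a. X = (\<Pi>\<^sub>E i\<in>J. {..a i}))" for X
  proof
    assume "X \<in> E"
    then obtain A where X: "X = {f\<in>(\<Pi>\<^sub>E i\<in>J. UNIV). \<forall>i\<in>J. f i \<in> A i}"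
      and A: "\<forall>i\<in>J. \<exists>a::real. A i = {..a}"
      unfolding E_def by blast
    from A obtain a where a: "\<And>i. i \<in> J \<Longrightarrow> A i = {..a i :: real}" by metis
    have "X = (\<Pi>\<^sub>E i\<in>J. {..a i})" unfolding X using a by (auto simp: PiE_iff extensional_def)
    then show "\<exists>a. X = (\<Pi>\<^sub>E i\<in>J. {..a i})" by blast
  next
    assume "\<exists>a. X = (\<Pi>\<^sub>E i\<in>J. {..a i})"
    then obtain a where X: "X = (\<Pi>\<^sub>E i\<in>J. {..a i})" ..
    have "X = {f\<in>(\<Pi>\<^sub>E i\<in>J. UNIV). \<forall>i\<in>J. f i \<in> {..a i}}" unfolding X by (auto simp: PiE_iff extensional_def)
    then show "X \<in> E" unfolding E_def by (intro CollectI exI[of _ "\<lambda>i. {..a i}"] exI[of _ J]) auto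
  qed
  have gen: "sets (\<Pi>\<^sub>M i\<in>J. borel) = sigma_sets (\<Pi>\<^sub>E i\<in>J. UNIV) E"
  proof -
    have "\<exists>S\<subseteq>range (\<lambda>a::real. {..a}). countable S \<and> UNIV = \<Union>S"
      by (intro exI[of _ "range (\<lambda>n::nat. {..real n})"]) (auto intro: real_arch_simple)
    then have "sets (\<Pi>\<^sub>M i\<in>J. sigma UNIV (range (\<lambda>a::real. {..a}))) = sets (sigma (\<Pi>\<^sub>E i\<in>J. UNIV) E)"
      unfolding E_def using J by (intro sets_PiM_sigma) auto
    moreover have "E \<subseteq> Pow (\<Pi>\<^sub>E i\<in>J. UNIV)" by (auto simp: E_def)
    ultimately show ?thesis
      by (simp flip: borel_eq_atMost)
  qed
  show ?thesis
  proof (rule measure_eqI_generator_eq[where E = E and \<Omega> = "\<Pi>\<^sub>E i\<in>J. UNIV" and A = "\<lambda>n. \<Pi>\<^sub>E i\<in>J. {..real n}"])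
    show "Int_stable E"
    proof (rule Int_stableI)
      fix X Y assume XY: "X \<in> E" "Y \<in> E"
      obtain a where "X = (\<Pi>\<^sub>E i\<in>J. {..a i})" using iffD1[OF box XY(1)] ..
      moreover obtain b where "Y = (\<Pi>\<^sub>E i\<in>J. {..b i})" using iffD1[OF box XY(2)] ..
      ultimately have "X \<inter> Y = (\<Pi>\<^sub>E i\<in>J. {..min (a i) (b i)})" by (simp add: PiE_Int)
      then show "X \<inter> Y \<in> E" unfolding box by (intro exI[of _ "\<lambda>i. min (a i) (b i)"])
    qed
    show "E \<subseteq> Pow (\<Pi>\<^sub>E i\<in>J. UNIV)" by (auto simp: E_def)
    show "emeasure P X = emeasure Q X" if "X \<in> E" for X
      using iffD1[OF box that] eq by (elim exE) simp
    show "sets P = sigma_sets (\<Pi>\<^sub>E i\<in>J. UNIV) E" "sets Q = sigma_sets (\<Pi>\<^sub>E i\<in>J. UNIV) E"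
      using sets gen by auto
    show "range (\<lambda>n. \<Pi>\<^sub>E i\<in>J. {..real n}) \<subseteq> E"
    proof (rule image_subsetI)
      show "(\<Pi>\<^sub>E i\<in>J. {..real n}) \<in> E" for n
        unfolding box by (rule exI[of _ "\<lambda>_. real n"]) simp
    qed
    show "(\<Union>n. \<Pi>\<^sub>E i\<in>J. {..real n}) = (\<Pi>\<^sub>E i\<in>J. UNIV)"
    proof (intro equalityI subsetI)
      fix f :: "'i \<Rightarrow> real" assume f: "f \<in> (\<Pi>\<^sub>E i\<in>J. UNIV)"
      obtain n :: nat where n: "(\<Sum>i\<in>J. \<bar>f i\<bar>) \<le> real n" using real_arch_simple by blast
      have "f i \<le> real n" if "i \<in> J" for i
        using member_le_sum[of i J "\<lambda>i. \<bar>f i\<bar>"] that J n by auto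
      then show "f \<in> (\<Union>n. \<Pi>\<^sub>E i\<in>J. {..real n})" using f by (auto simp: PiE_iff)
    qed auto
    show "emeasure P (\<Pi>\<^sub>E i\<in>J. {..real n}) \<noteq> \<infinity>" for n
      using fin by (simp add: finite_measure.emeasure_finite)
  qed
qed

context prob_space
begin

text \<open>A smoothed joint distribution function: as \<open>m\<close> grows it tends to the
  probability that \<open>V j \<le> a j\<close> for all \<open>j\<close> in
  \<open>J\<close>.\<close>

definition test_expectation :: "real set \<Rightarrow> nat \<Rightarrow> (real \<Rightarrow> real) \<Rightarrow> (real \<Rightarrow> 'a \<Rightarrow> real) \<Rightarrow> real" where
  "test_expectation J m a V = expectation (\<lambda>\<omega>. \<Prod>j\<in>J. soft_le m (V j \<omega> - a j))"

lemma test_expectation_cong_law: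
  assumes [measurable]: "\<And>j. V j \<in> borel_measurable M" "\<And>j. W j \<in> borel_measurable M"
    and "finite J" "fdd M V J = fdd M W J"
  shows "test_expectation J m a V = test_expectation J m a W"
proof -
  have [measurable]: "(\<lambda>x. \<Prod>j\<in>J. soft_le m (x j - a j)) \<in> borel_measurable (\<Pi>\<^sub>M t\<in>J. borel)"
    by measurable
  have *: "test_expectation J m a V = (\<integral>x. (\<Prod>j\<in>J. soft_le m (x j - a j)) \<partial>fdd M V J)"
    if [measurable]: "\<And>j. V j \<in> borel_measurable M" for V
    unfolding test_expectation_def fdd_def by (subst integral_distr) auto
  show ?thesis using assms by (simp add: *)
qed

text \<open>Dominated convergence in \<open>m\<close> recovers the joint distribution functions from
  the test expectations, and these determine the law.\<close>

lemma fdd_eqI_test_expectation: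
  assumes [measurable]: "\<And>j. V j \<in> borel_measurable M" "\<And>j. W j \<in> borel_measurable M"
    and J: "finite J"
    and eq: "\<And>m a. test_expectation J m a V = test_expectation J m a W"
  shows "fdd M V J = fdd M W J"
proof (rule measure_eqI_PiM_atMost[OF J])
  show "sets (fdd M V J) = sets (\<Pi>\<^sub>M i\<in>J. borel)" "sets (fdd M W J) = sets (\<Pi>\<^sub>M i\<in>J. borel)"
    by (auto simp: fdd_def)
  have fin: "finite_measure (fdd M V J)" if [measurable]: "\<And>j. V j \<in> borel_measurable M" for V
    unfolding fdd_def by (intro finite_measure_distr) measurable
  then show "finite_measure (fdd M V J)" by simp
  fix a :: "real \<Rightarrow> real"
  have lim: "(\<lambda>m. test_expectation J m a V) \<longlonglongrightarrow> measure (fdd M V J) (\<Pi>\<^sub>E i\<in>J. {..a i})"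
    if [measurable]: "\<And>j. V j \<in> borel_measurable M" for V
  proof -
    have lim': "(\<lambda>m. expectation (\<lambda>\<omega>. \<Prod>j\<in>J. soft_le m (V j \<omega> - a j)))
        \<longlonglongrightarrow> expectation (\<lambda>\<omega>. \<Prod>j\<in>J. if V j \<omega> - a j \<le> 0 then 1 else 0)"
    proof (rule integral_dominated_convergence[where w = "\<lambda>_. 1"])
      show "AE \<omega> in M. (\<lambda>m. \<Prod>j\<in>J. soft_le m (V j \<omega> - a j)) \<longlonglongrightarrow> (\<Prod>j\<in>J. if V j \<omega> - a j \<le> 0 then 1 else 0)"
        by (intro AE_I2 tendsto_prod soft_le_tendsto)
      show "AE \<omega> in M. norm (\<Prod>j\<in>J. soft_le m (V j \<omega> - a j)) \<le> 1" for m
        by (intro AE_I2) (auto simp: abs_prod soft_le_bounds intro!: prod_le_1)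
    qed auto
    have "expectation (\<lambda>\<omega>. \<Prod>j\<in>J. if V j \<omega> - a j \<le> 0 then 1 else 0 :: real)
        = expectation (indicat_real {\<omega>\<in>space M. \<forall>j\<in>J. V j \<omega> \<le> a j})"
    proof (rule Bochner_Integration.integral_cong[OF refl])
      fix \<omega> assume "\<omega> \<in> space M"
      have "(\<Prod>j\<in>J. if V j \<omega> - a j \<le> 0 then 1 else 0 :: real)
          = (if \<forall>j\<in>J. V j \<omega> \<le> a j then 1 else 0)"
        using J by (induction J rule: finite_induct) auto
      moreover have "indicat_real {\<omega>\<in>space M. \<forall>j\<in>J. V j \<omega> \<le> a j} \<omega>
          = (if \<forall>j\<in>J. V j \<omega> \<le> a j then 1 else 0)"
        using \<open>\<omega> \<in> space M\<close> by (auto simp: indicator_def)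
      ultimately show "(\<Prod>j\<in>J. if V j \<omega> - a j \<le> 0 then 1 else 0)
          = indicat_real {\<omega>\<in>space M. \<forall>j\<in>J. V j \<omega> \<le> a j} \<omega>"
        by (rule trans[OF _ sym])
    qed
    also have "\<dots> = prob {\<omega>\<in>space M. \<forall>j\<in>J. V j \<omega> \<le> a j}"
      by (subst Bochner_Integration.integral_indicator) (simp add: Int_def conj_ac)
    also have "{\<omega>\<in>space M. \<forall>j\<in>J. V j \<omega> \<le> a j} = (\<lambda>\<omega>. \<lambda>t\<in>J. V t \<omega>) -` (\<Pi>\<^sub>E i\<in>J. {..a i}) \<inter> space M"
      by (auto simp: PiE_iff)
    also have "prob \<dots> = measure (fdd M V J) (\<Pi>\<^sub>E i\<in>J. {..a i})"
      unfolding fdd_def using J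
      by (intro measure_distr[symmetric] sets_PiM_I_finite measurable_restrict) simp_all
    finally show ?thesis using lim' unfolding test_expectation_def by (simp only:)
  qed
  have "measure (fdd M V J) (\<Pi>\<^sub>E i\<in>J. {..a i}) = measure (fdd M W J) (\<Pi>\<^sub>E i\<in>J. {..a i})"
    using LIMSEQ_unique[OF lim[of V]] lim[of W] by (simp add: eq)
  then show "emeasure (fdd M V J) (\<Pi>\<^sub>E i\<in>J. {..a i}) = emeasure (fdd M W J) (\<Pi>\<^sub>E i\<in>J. {..a i})"
    using fin by (simp add: finite_measure.emeasure_eq_measure)
qed

text \<open>Products of numbers in \<open>[0, 1]\<close> differ by at most the sum of the
  differences of their factors. Both families vary with \<open>n\<close>, because the uniqueness
  argument lets two processes move in time together.\<close>

lemma test_expectation_diff_tendsto_0: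
  assumes [measurable]: "\<And>n j. V n j \<in> borel_measurable M" "\<And>n j. W n j \<in> borel_measurable M"
    and lim: "\<And>j. j \<in> J \<Longrightarrow> (\<lambda>n. expectation (\<lambda>\<omega>. min 1 \<bar>V n j \<omega> - W n j \<omega>\<bar>)) \<longlonglongrightarrow> 0"
  shows "(\<lambda>n. test_expectation J m a (V n) - test_expectation J m a (W n)) \<longlonglongrightarrow> 0"
proof -
  have int: "integrable M (\<lambda>\<omega>. \<Prod>j\<in>J. soft_le m (V j \<omega> - a j))"
    if [measurable]: "\<And>j. V j \<in> borel_measurable M" for V
    by (intro integrable_const_bound[where B = 1])(auto simp: abs_prod soft_le_bounds intro!: prod_le_1)
  have imin: "integrable M (\<lambda>\<omega>. min 1 \<bar>V n j \<omega> - W n j \<omega>\<bar>)" for n j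
    by (intro integrable_const_bound[where B = 1]) auto
  have "\<bar>test_expectation J m a (V n) - test_expectation J m a (W n)\<bar>
      \<le> (\<Sum>j\<in>J. max 1 (real m) * expectation (\<lambda>\<omega>. min 1 \<bar>V n j \<omega> - W n j \<omega>\<bar>))" for n
  proof -
    have pw: "\<bar>(\<Prod>j\<in>J. soft_le m (V n j \<omega> - a j)) - (\<Prod>j\<in>J. soft_le m (W n j \<omega> - a j))\<bar>
        \<le> (\<Sum>j\<in>J. max 1 (real m) * min 1 \<bar>V n j \<omega> - W n j \<omega>\<bar>)" for \<omega>
    proof -
      have "norm ((\<Prod>j\<in>J. soft_le m (V n j \<omega> - a j)) - (\<Prod>j\<in>J. soft_le m (W n j \<omega> - a j)))
          \<le> (\<Sum>j\<in>J. norm (soft_le m (V n j \<omega> - a j) - soft_le m (W n j \<omega> - a j)))"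
        by (intro norm_prod_diff) (auto simp: soft_le_bounds)
      also have "\<dots> \<le> (\<Sum>j\<in>J. max 1 (real m) * min 1 \<bar>V n j \<omega> - W n j \<omega>\<bar>)"
        using soft_le_lipschitz[of m "V n j \<omega> - a j" "W n j \<omega> - a j" for j]
        by (intro sum_mono) auto
      finally show ?thesis by simp
    qed
    have "\<bar>test_expectation J m a (V n) - test_expectation J m a (W n)\<bar>
      \<le> expectation (\<lambda>\<omega>. \<bar>(\<Prod>j\<in>J. soft_le m (V n j \<omega> - a j)) - (\<Prod>j\<in>J. soft_le m (W n j \<omega> - a j))\<bar>)"
      unfolding test_expectation_def
      by (subst Bochner_Integration.integral_diff[symmetric]) (auto intro!: int integral_abs_bound)
    also have "\<dots> \<le> expectation (\<lambda>\<omega>. \<Sum>j\<in>J. max 1 (real m) * min 1 \<bar>V n j \<omega> - W n j \<omega>\<bar>)"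
      using pw imin int by (intro integral_mono) auto
    also have "\<dots> = (\<Sum>j\<in>J. max 1 (real m) * expectation (\<lambda>\<omega>. min 1 \<bar>V n j \<omega> - W n j \<omega>\<bar>))"
      using imin by (subst Bochner_Integration.integral_sum) auto
    finally show ?thesis .
  qed
  then have bound: "\<forall>\<^sub>F n in sequentially. norm (test_expectation J m a (V n) - test_expectation J m a (W n))
      \<le> (\<Sum>j\<in>J. max 1 (real m) * expectation (\<lambda>\<omega>. min 1 \<bar>V n j \<omega> - W n j \<omega>\<bar>))"
    by simp
  have "(\<lambda>n. \<Sum>j\<in>J. max 1 (real m) * expectation (\<lambda>\<omega>. min 1 \<bar>V n j \<omega> - W n j \<omega>\<bar>))
      \<longlonglongrightarrow> (\<Sum>j\<in>J. max 1 (real m) * 0)"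
    by (intro tendsto_sum tendsto_mult tendsto_const lim)
  then have "(\<lambda>n. \<Sum>j\<in>J. max 1 (real m) * expectation (\<lambda>\<omega>. min 1 \<bar>V n j \<omega> - W n j \<omega>\<bar>)) \<longlonglongrightarrow> 0"
    by simp
  with bound show ?thesis
    by (rule Lim_null_comparison)
qed

end

subsection \<open>Moments of stationary increments\<close>

text \<open>The exponent is a locale parameter so that one set of estimates serves the laws, through
  \<open>p = 1\<close>, and the statements in \<open>L^p\<close>.\<close>

locale stationary_increment_process = prob_space M
  for M :: "'a measure" +
  fixes N :: "real \<Rightarrow> 'a \<Rightarrow> real" and p :: real
  assumes measurable_process: "measurable_process M N"
    and stationary_increments: "stationary_increments M N"
    and p_ge_1: "1 \<le> p"
    and finite_moments: "finite_moments M p N"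
begin

lemma N_measurable_comp [measurable (raw)]:
  assumes "f \<in> borel_measurable K" "g \<in> measurable K M"
  shows "(\<lambda>x. N (f x) (g x)) \<in> borel_measurable K"
  using measurable_compose[OF measurable_Pair[OF assms] measurable_process[unfolded measurable_process_def]]
  by simp

lemma N_measurable [measurable]: "N t \<in> borel_measurable M"
  using N_measurable_comp[OF measurable_const[of t borel M] measurable_ident] by (simp add: id_def)

lemma path_measurable: "\<omega> \<in> space M \<Longrightarrow> (\<lambda>t. N t \<omega>) \<in> borel_measurable borel"
  by measurable

lemma moment_integrable: "integrable M (\<lambda>\<omega>. \<bar>N t \<omega>\<bar> powr p)"
  using finite_moments by (simp add: finite_moments_def)

lemma increment_integrable: "integrable M (\<lambda>\<omega>. \<bar>N s \<omega> - N t \<omega>\<bar> powr p)"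
proof (rule Bochner_Integration.integrable_bound)
  show "integrable M (\<lambda>\<omega>. 2 powr p * (\<bar>N s \<omega>\<bar> powr p + \<bar>N t \<omega>\<bar> powr p))"
    by (intro integrable_mult_right Bochner_Integration.integrable_add moment_integrable)
  show "AE \<omega> in M. norm (\<bar>N s \<omega> - N t \<omega>\<bar> powr p)
      \<le> norm (2 powr p * (\<bar>N s \<omega>\<bar> powr p + \<bar>N t \<omega>\<bar> powr p))"
    using powr_abs_diff_le[OF p_ge_1] by (intro AE_I2) simp
qed measurable

definition incr_moment :: "real \<Rightarrow> real" where
  "incr_moment h = expectation (\<lambda>\<omega>. \<bar>N h \<omega> - N 0 \<omega>\<bar> powr p)"

lemma incr_moment_measurable [measurable]: "incr_moment \<in> borel_measurable borel"
  unfolding incr_moment_def by measurable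

lemma incr_moment_nonneg: "0 \<le> incr_moment h"
  by (simp add: incr_moment_def)

lemma incr_moment_0 [simp]: "incr_moment 0 = 0"
  by (simp add: incr_moment_def)

lemma increment_moment: "expectation (\<lambda>\<omega>. \<bar>N a \<omega> - N b \<omega>\<bar> powr p) = incr_moment (a - b)"
proof -
  let ?J = "{a - b}"
  have [measurable]: "(\<lambda>x. \<bar>x (a - b)\<bar> powr p) \<in> borel_measurable (\<Pi>\<^sub>M t\<in>?J. borel)"
    by measurable
  have "expectation (\<lambda>\<omega>. \<bar>N (a - b + b) \<omega> - N b \<omega>\<bar> powr p)
      = (\<integral>x. \<bar>x (a - b)\<bar> powr p \<partial>fdd M (\<lambda>t \<omega>. N (t + b) \<omega> - N b \<omega>) ?J)"
    unfolding fdd_def by (subst integral_distr) auto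
  also have "fdd M (\<lambda>t \<omega>. N (t + b) \<omega> - N b \<omega>) ?J = fdd M (\<lambda>t \<omega>. N t \<omega> - N 0 \<omega>) ?J"
    using stationary_increments by (simp add: stationary_increments_def equal_in_law_def)
  also have "(\<integral>x. \<bar>x (a - b)\<bar> powr p \<partial>fdd M (\<lambda>t \<omega>. N t \<omega> - N 0 \<omega>) ?J) = incr_moment (a - b)"
    unfolding fdd_def incr_moment_def by (subst integral_distr) auto
  finally show ?thesis by simp
qed

lemma incr_moment_minus: "incr_moment (- h) = incr_moment h"
  using increment_moment[of 0 h] increment_moment[of h 0] by (simp add: abs_minus_commute)

lemma incr_moment_add_le: "incr_moment (s + t) \<le> 2 powr p * (incr_moment s + incr_moment t)"
proof -
  have "incr_moment (s + t) \<le>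
      expectation (\<lambda>\<omega>. 2 powr p * (\<bar>N (s + t) \<omega> - N t \<omega>\<bar> powr p + \<bar>N t \<omega> - N 0 \<omega>\<bar> powr p))"
    unfolding incr_moment_def
  proof (rule integral_mono)
    show "\<bar>N (s + t) \<omega> - N 0 \<omega>\<bar> powr p
        \<le> 2 powr p * (\<bar>N (s + t) \<omega> - N t \<omega>\<bar> powr p + \<bar>N t \<omega> - N 0 \<omega>\<bar> powr p)" for \<omega>
      using powr_abs_add_le[OF p_ge_1, of "N (s + t) \<omega> - N t \<omega>" "N t \<omega> - N 0 \<omega>"] by simp
  qed (simp_all add: increment_integrable)
  also have "\<dots> = 2 powr p * (incr_moment s + incr_moment t)"
    using increment_moment[of "s + t" t] increment_moment[of t 0] by (simp add: increment_integrable)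
  finally show ?thesis .
qed

text \<open>The increment over \<open>n * h\<close> is a sum of \<open>n\<close> increments with
  equal moments. Treating all \<open>n\<close> at once keeps the factor polynomial; adding one step
  at a time would lose a factor \<open>2 powr p\<close> per step.\<close>

lemma incr_moment_mult_le:
  assumes "0 < n"
  shows "incr_moment (real n * h) \<le> real n powr p * incr_moment h"
proof -
  define D where "D i \<omega> = N (real (Suc i) * h) \<omega> - N (real i * h) \<omega>" for i \<omega>
  have D_int: "integrable M (\<lambda>\<omega>. \<bar>D i \<omega>\<bar> powr p)" for i
    unfolding D_def by (rule increment_integrable)
  have D_moment: "expectation (\<lambda>\<omega>. \<bar>D i \<omega>\<bar> powr p) = incr_moment h" for i
    unfolding D_def increment_moment by (simp add: algebra_simps)
  have "N (real n * h) \<omega> - N 0 \<omega> = (\<Sum>i<n. D i \<omega>)" for \<omega>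
    using sum_lessThan_telescope[of "\<lambda>i. N (real i * h) \<omega>" n] by (simp add: D_def)
  then have "incr_moment (real n * h) = expectation (\<lambda>\<omega>. \<bar>\<Sum>i<n. D i \<omega>\<bar> powr p)"
    by (simp add: incr_moment_def)
  also have "\<dots> \<le> expectation (\<lambda>\<omega>. real n powr (p - 1) * (\<Sum>i<n. \<bar>D i \<omega>\<bar> powr p))"
  proof (rule Bochner_Integration.integral_mono')
    show "integrable M (\<lambda>\<omega>. real n powr (p - 1) * (\<Sum>i<n. \<bar>D i \<omega>\<bar> powr p))"
      by (intro integrable_mult_right Bochner_Integration.integrable_sum D_int)
    show "\<bar>\<Sum>i<n. D i \<omega>\<bar> powr p \<le> real n powr (p - 1) * (\<Sum>i<n. \<bar>D i \<omega>\<bar> powr p)" for \<omega>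
      by (rule powr_abs_sum_le[OF p_ge_1 assms])
    show "0 \<le> real n powr (p - 1) * (\<Sum>i<n. \<bar>D i \<omega>\<bar> powr p)" for \<omega>
      by (intro mult_nonneg_nonneg sum_nonneg) auto
  qed
  also have "\<dots> = real n powr (p - 1) * (\<Sum>i<n. incr_moment h)"
    using D_int by (simp add: D_moment)
  also have "\<dots> = real n powr p * incr_moment h"
    using assms by (simp add: powr_diff)
  finally show ?thesis .
qed

text \<open>If \<open>incr_moment\<close> exceeds a level \<open>n\<close> only on a subset of \<open>[-1, 1]\<close> of measure less than
  \<open>1/2\<close>, then every \<open>t \<in> [0, 1]\<close> is a sum of two points at which it does not.\<close>
lemma incr_moment_locally_bounded:
  obtains B where "0 \<le> B" "\<And>t. 0 \<le> t \<Longrightarrow> t \<le> 1 \<Longrightarrow> incr_moment t \<le> B"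
proof -
  \<comment> \<open>The window contains both \<open>s\<close> and \<open>t - s\<close> for all
    \<open>s\<close> and \<open>t\<close> in \<open>[0, 1]\<close>.\<close>
  define A where "A n = {s\<in>{-1..1}. real n < incr_moment s}" for n
  have [measurable]: "A n \<in> sets borel" for n unfolding A_def by measurable
  have int_A: "integrable lborel (indicat_real (A n))" for n
    by (rule Bochner_Integration.integrable_bound[of lborel "indicat_real {-1..1}"])
       (auto simp: A_def indicator_def)
  have "(\<lambda>n. \<integral>s. indicat_real (A n) s \<partial>lborel) \<longlonglongrightarrow> (\<integral>s. 0 \<partial>(lborel :: real measure))"
  proof (rule integral_dominated_convergence[where w = "indicat_real {-1..1}"])
    show "AE s in lborel. (\<lambda>n. indicat_real (A n) s) \<longlonglongrightarrow> 0"
    proof (rule AE_I2, rule tendsto_eventually)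
      fix s
      obtain n0 :: nat where "incr_moment s \<le> real n0" using real_arch_simple by blast
      then have "\<forall>n\<ge>n0. indicat_real (A n) s = 0" by (auto simp: A_def indicator_def)
      then show "\<forall>\<^sub>F n in sequentially. indicat_real (A n) s = 0"
        unfolding eventually_sequentially by blast
    qed
  qed (auto simp: A_def indicator_def)
  then have "\<forall>\<^sub>F n in sequentially. (\<integral>s. indicat_real (A n) s \<partial>lborel) < 1 / 2"
    by (rule order_tendstoD(2)) simp
  then obtain n where n: "(\<integral>s. indicat_real (A n) s \<partial>lborel) < 1 / 2"
    unfolding eventually_sequentially by blast
  show thesis
  proof
    show "0 \<le> 2 powr p * (real n + real n)" by simp
    fix t :: real assume t: "0 \<le> t" "t \<le> 1"
    \<comment> \<open>Otherwise \<open>A n\<close> and its reflection under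
      \<open>s \<mapsto> t - s\<close> would cover \<open>[0, 1]\<close>, although their measures
      add up to less than 1.\<close>
    have "\<exists>s\<in>{0..1}. s \<notin> A n \<and> t - s \<notin> A n"
    proof (rule ccontr)
      assume neg: "\<not> ?thesis"
      have refl: "integrable lborel (\<lambda>s. indicat_real (A n) (t - s))"
        using lborel_integrable_real_affine[OF int_A, of "-1" n t] by simp
      have "1 = (\<integral>s. indicat_real {0..1::real} s \<partial>lborel)"
        by simp
      also have "\<dots> \<le> (\<integral>s. indicat_real (A n) s + indicat_real (A n) (t - s) \<partial>lborel)"
      proof (rule integral_mono)
        show "indicat_real {0..1} s \<le> indicat_real (A n) s + indicat_real (A n) (t - s)" for s
          using neg by (auto simp: indicator_def)
      qed (simp_all add: int_A refl)
      also have "\<dots> = (\<integral>s. indicat_real (A n) s \<partial>lborel) + (\<integral>s. indicat_real (A n) (t - s) \<partial>lborel)"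
        by (rule Bochner_Integration.integral_add[OF int_A refl])
      also have "(\<integral>s. indicat_real (A n) (t - s) \<partial>lborel) = (\<integral>s. indicat_real (A n) s \<partial>lborel)"
        using lborel_integral_real_affine[of "-1" "indicat_real (A n)" t] by simp
      finally show False using n by linarith
    qed
    then obtain s where "s \<in> {0..1}" "s \<notin> A n" "t - s \<notin> A n" by blast
    then have "incr_moment s + incr_moment (t - s) \<le> real n + real n"
      using t by (auto simp: A_def not_less intro!: add_mono)
    then have "2 powr p * (incr_moment s + incr_moment (t - s)) \<le> 2 powr p * (real n + real n)"
      by (rule mult_left_mono) simp
    moreover have "incr_moment t \<le> 2 powr p * (incr_moment s + incr_moment (t - s))"
      using incr_moment_add_le[of s "t - s"] by simp
    ultimately show "incr_moment t \<le> 2 powr p * (real n + real n)"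
      by (rule order_trans[rotated])
  qed
qed

lemma incr_moment_growth:
  assumes "0 < c"
  obtains A where "0 \<le> A" "\<And>t. incr_moment t \<le> A * exp (c * \<bar>t\<bar>)"
proof -
  obtain B where B: "0 \<le> B" "\<And>t. 0 \<le> t \<Longrightarrow> t \<le> 1 \<Longrightarrow> incr_moment t \<le> B"
    using incr_moment_locally_bounded by blast
  define K where "K = (p / c) powr p * exp c"
  have pos: "incr_moment t \<le> (K * B) * exp (c * t)" if "0 \<le> t" for t
  proof -
    \<comment> \<open>Then \<open>t / n\<close> lies in \<open>[0, 1]\<close>, where the local bound
      applies, and \<open>n \<le> 1 + t\<close> makes the factor \<open>n powr p\<close> polynomial
      in \<open>t\<close>.\<close>
    define n where "n = Suc (nat \<lfloor>t\<rfloor>)"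
    have n: "t \<le> real n" "real n \<le> 1 + t" "0 < n" using that by (auto simp: n_def) linarith+
    have "incr_moment t = incr_moment (real n * (t / real n))" using n by simp
    also have "\<dots> \<le> real n powr p * incr_moment (t / real n)"
      by (rule incr_moment_mult_le[OF n(3)])
    also have "\<dots> \<le> (1 + t) powr p * B"
      using n that p_ge_1 by (intro mult_mono powr_mono2 B incr_moment_nonneg) auto
    also have "\<dots> \<le> (K * exp (c * t)) * B"
      using powr_le_exp[OF assms, of p t] p_ge_1 that B by (intro mult_right_mono) (auto simp: K_def)
    finally show ?thesis by (simp add: mult_ac)
  qed
  show thesis
  proof
    show "0 \<le> K * B" using B by (simp add: K_def)
    show "incr_moment t \<le> (K * B) * exp (c * \<bar>t\<bar>)" for t
      using pos[of t] pos[of "- t"] incr_moment_minus[of t] by (cases "0 \<le> t") auto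
  qed
qed

lemma moment_growth:
  assumes "0 < c"
  obtains A where "0 \<le> A" "\<And>t. expectation (\<lambda>\<omega>. \<bar>N t \<omega>\<bar> powr p) \<le> A * exp (c * \<bar>t\<bar>)"
proof -
  obtain B where B: "0 \<le> B" "\<And>t. incr_moment t \<le> B * exp (c * \<bar>t\<bar>)"
    using incr_moment_growth[OF assms] by blast
  define D where "D = expectation (\<lambda>\<omega>. \<bar>N 0 \<omega>\<bar> powr p)"
  show thesis
  proof
    show "0 \<le> 2 powr p * (B + D)" using B by (simp add: D_def)
    fix t
    have "expectation (\<lambda>\<omega>. \<bar>N t \<omega>\<bar> powr p)
        \<le> expectation (\<lambda>\<omega>. 2 powr p * (\<bar>N t \<omega> - N 0 \<omega>\<bar> powr p + \<bar>N 0 \<omega>\<bar> powr p))"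
    proof (rule integral_mono)
      show "\<bar>N t \<omega>\<bar> powr p \<le> 2 powr p * (\<bar>N t \<omega> - N 0 \<omega>\<bar> powr p + \<bar>N 0 \<omega>\<bar> powr p)" for \<omega>
        using powr_abs_add_le[OF p_ge_1, of "N t \<omega> - N 0 \<omega>" "N 0 \<omega>"] by simp
    qed (simp_all add: increment_integrable moment_integrable)
    also have "\<dots> = 2 powr p * (incr_moment t + D)"
      by (simp add: increment_integrable moment_integrable incr_moment_def D_def)
    also have "\<dots> \<le> 2 powr p * (B * exp (c * \<bar>t\<bar>) + D * exp (c * \<bar>t\<bar>))"
    proof (intro mult_left_mono add_mono B)
      have "0 \<le> D" by (simp add: D_def)
      moreover have "1 \<le> exp (c * \<bar>t\<bar>)" using assms by simp
      ultimately show "D \<le> D * exp (c * \<bar>t\<bar>)" using mult_left_mono[of 1 "exp (c * \<bar>t\<bar>)" D] by simp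
    qed simp
    finally show "expectation (\<lambda>\<omega>. \<bar>N t \<omega>\<bar> powr p) \<le> 2 powr p * (B + D) * exp (c * \<bar>t\<bar>)"
      by (simp add: algebra_simps)
  qed
qed

text \<open>By stationarity, \<open>incr_moment h\<close> is the average over \<open>t\<close> in \<open>[0, 1]\<close> of the \<open>p\<close>-th moment of
  \<open>N (t + h) - N t\<close>, which vanishes as \<open>h \<rightarrow> 0\<close> by continuity of translation in \<open>L\<^sup>p\<close> along
  the paths.\<close>
lemma incr_moment_isCont_0: "isCont incr_moment 0"
proof (unfold continuous_at_sequentially, intro allI impI)
  fix h :: "nat \<Rightarrow> real" assume h: "h \<longlonglongrightarrow> 0"
  interpret P: pair_sigma_finite lborel M
    by (rule pair_sigma_finite.intro[OF sigma_finite_lborel sigma_finite_measure_axioms])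
  \<comment> \<open>The cut-off makes almost every path integrable over the whole line. The window
    contains \<open>t\<close> and \<open>t + h\<close> whenever \<open>t\<close> is in
    \<open>[0, 1]\<close> and \<open>\<bar>h\<bar> \<le> 1\<close>.\<close>
  define f where "f \<omega> t = indicator {-1..2} t * N t \<omega>" for \<omega> and t :: real
  have f_powr: "\<bar>f \<omega> t\<bar> powr p = indicator {-1..2} t * \<bar>N t \<omega>\<bar> powr p" for \<omega> t
    by (auto simp: f_def indicator_def)
  obtain A where A: "0 \<le> A" "\<And>t. expectation (\<lambda>\<omega>. \<bar>N t \<omega>\<bar> powr p) \<le> A * exp (1 * \<bar>t\<bar>)"
    using moment_growth[of 1] by auto
  have f_int: "integrable (lborel \<Otimes>\<^sub>M M) (\<lambda>x. \<bar>f (snd x) (fst x + c)\<bar> powr p)" for c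
  proof (rule P.Fubini_integrable)
    have f_le: "expectation (\<lambda>\<omega>. \<bar>f \<omega> t\<bar> powr p) \<le> indicator {-1..2} t * (A * exp 2)" for t
    proof (cases "t \<in> {-1..2}")
      case True
      then have "A * exp \<bar>t\<bar> \<le> A * exp 2" by (intro mult_left_mono A) auto
      then show ?thesis using A(2)[of t] True by (simp add: f_powr)
    qed (simp add: f_powr)
    have "integrable lborel (\<lambda>t. expectation (\<lambda>\<omega>. \<bar>f \<omega> t\<bar> powr p))"
    proof (rule Bochner_Integration.integrable_bound)
      show "integrable lborel (\<lambda>t. indicator {-1..2::real} t * (A * exp 2))" by simp
      show "AE t in lborel. norm (expectation (\<lambda>\<omega>. \<bar>f \<omega> t\<bar> powr p)) \<le> norm (indicator {-1..2} t * (A * exp 2))"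
        using f_le A(1) by (intro AE_I2) simp
      show "(\<lambda>t. expectation (\<lambda>\<omega>. \<bar>f \<omega> t\<bar> powr p)) \<in> borel_measurable lborel"
        unfolding f_def by measurable
    qed
    from lborel_integrable_real_affine[OF this, of 1 c]
    show "integrable lborel (\<lambda>t. expectation (\<lambda>\<omega>. norm (\<bar>f (snd (t, \<omega>)) (fst (t, \<omega>) + c)\<bar> powr p)))"
      by (simp add: add.commute)
    show "AE t in lborel. integrable M (\<lambda>\<omega>. \<bar>f (snd (t, \<omega>)) (fst (t, \<omega>) + c)\<bar> powr p)"
      by (simp add: f_powr moment_integrable)
    show "(\<lambda>x. \<bar>f (snd x) (fst x + c)\<bar> powr p) \<in> borel_measurable (lborel \<Otimes>\<^sub>M M)"
      unfolding f_def by measurable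
  qed
  have d_int: "integrable (lborel \<Otimes>\<^sub>M M) (\<lambda>(t, \<omega>). \<bar>f \<omega> (t + c) - f \<omega> t\<bar> powr p)" for c
  proof (rule Bochner_Integration.integrable_bound)
    show "integrable (lborel \<Otimes>\<^sub>M M)
        (\<lambda>x. 2 powr p * (\<bar>f (snd x) (fst x + c)\<bar> powr p + \<bar>f (snd x) (fst x + 0)\<bar> powr p))"
      by (intro integrable_mult_right Bochner_Integration.integrable_add f_int)
    show "AE x in lborel \<Otimes>\<^sub>M M. norm (case x of (t, \<omega>) \<Rightarrow> \<bar>f \<omega> (t + c) - f \<omega> t\<bar> powr p)
        \<le> norm (2 powr p * (\<bar>f (snd x) (fst x + c)\<bar> powr p + \<bar>f (snd x) (fst x + 0)\<bar> powr p))"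
      using powr_abs_diff_le[OF p_ge_1] by (intro AE_I2) (simp add: case_prod_beta')
    show "(\<lambda>(t, \<omega>). \<bar>f \<omega> (t + c) - f \<omega> t\<bar> powr p) \<in> borel_measurable (lborel \<Otimes>\<^sub>M M)"
      unfolding f_def by measurable
  qed
  have "(\<lambda>n. expectation (\<lambda>\<omega>. \<integral>t. \<bar>f \<omega> (t + h n) - f \<omega> t\<bar> powr p \<partial>lborel)) \<longlonglongrightarrow> expectation (\<lambda>\<omega>. 0 :: real)"
  \<comment> \<open>Translation invariance of Lebesgue measure gives the shifted path the same norm,
    so the dominating function does not depend on the shift.\<close>
  proof (rule integral_dominated_convergence[where w = "\<lambda>\<omega>. 2 powr p * (2 * (\<integral>t. \<bar>f \<omega> t\<bar> powr p \<partial>lborel))"])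
    have AE_f: "AE \<omega> in M. integrable lborel (\<lambda>t. \<bar>f \<omega> t\<bar> powr p)"
      using P.AE_integrable_snd[of "\<lambda>t \<omega>. \<bar>f \<omega> t\<bar> powr p"] f_int[of 0] by (simp add: case_prod_beta')
    show "integrable M (\<lambda>\<omega>. 2 powr p * (2 * (\<integral>t. \<bar>f \<omega> t\<bar> powr p \<partial>lborel)))"
      using P.integrable_snd[of "\<lambda>t \<omega>. \<bar>f \<omega> t\<bar> powr p"] f_int[of 0] by (simp add: case_prod_beta')
    show "AE \<omega> in M. (\<lambda>n. \<integral>t. \<bar>f \<omega> (t + h n) - f \<omega> t\<bar> powr p \<partial>lborel) \<longlonglongrightarrow> 0"
      using AE_f AE_space
    proof eventually_elim
      fix \<omega> assume int: "integrable lborel (\<lambda>t. \<bar>f \<omega> t\<bar> powr p)" and om [measurable]: "\<omega> \<in> space M"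
      have f_le: "\<bar>f \<omega> t\<bar> \<le> indicator {-1..2} t + \<bar>f \<omega> t\<bar> powr p" for t
        using abs_le_1_plus_powr[OF p_ge_1, of "f \<omega> t"] by (auto simp: f_def indicator_def)
      have "integrable lborel (f \<omega>)"
      proof (rule Bochner_Integration.integrable_bound)
        show "integrable lborel (\<lambda>t. indicator {-1..2} t + \<bar>f \<omega> t\<bar> powr p)"
          using int by simp
        show "AE t in lborel. norm (f \<omega> t) \<le> norm (indicator {-1..2} t + \<bar>f \<omega> t\<bar> powr p)"
          using f_le by (intro AE_I2) (simp add: abs_of_nonneg)
        show "f \<omega> \<in> borel_measurable lborel"
          unfolding f_def by measurable
      qed
      then show "(\<lambda>n. \<integral>t. \<bar>f \<omega> (t + h n) - f \<omega> t\<bar> powr p \<partial>lborel) \<longlonglongrightarrow> 0"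
        by (rule translation_Lp_tendsto[OF p_ge_1 _ int h])
    qed
    show "AE \<omega> in M. norm (\<integral>t. \<bar>f \<omega> (t + h n) - f \<omega> t\<bar> powr p \<partial>lborel)
        \<le> 2 powr p * (2 * (\<integral>t. \<bar>f \<omega> t\<bar> powr p \<partial>lborel))" for n
      using AE_f AE_space
    proof eventually_elim
      fix \<omega> assume int: "integrable lborel (\<lambda>t. \<bar>f \<omega> t\<bar> powr p)" and om [measurable]: "\<omega> \<in> space M"
      have int': "integrable lborel (\<lambda>t. \<bar>f \<omega> (t + h n)\<bar> powr p)"
        using lborel_integrable_real_affine[OF int, of 1 "h n"] by (simp add: add.commute)
      have "(\<integral>t. \<bar>f \<omega> (t + h n) - f \<omega> t\<bar> powr p \<partial>lborel)
          \<le> (\<integral>t. 2 powr p * (\<bar>f \<omega> (t + h n)\<bar> powr p + \<bar>f \<omega> t\<bar> powr p) \<partial>lborel)"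
        using powr_abs_diff_le[OF p_ge_1] int int'
        by (intro Bochner_Integration.integral_mono') simp_all
      also have "\<dots> = 2 powr p * ((\<integral>t. \<bar>f \<omega> (t + h n)\<bar> powr p \<partial>lborel) + (\<integral>t. \<bar>f \<omega> t\<bar> powr p \<partial>lborel))"
        using int int' by simp
      also have "(\<integral>t. \<bar>f \<omega> (t + h n)\<bar> powr p \<partial>lborel) = (\<integral>t. \<bar>f \<omega> t\<bar> powr p \<partial>lborel)"
        using lborel_integral_real_affine[of 1 "\<lambda>t. \<bar>f \<omega> t\<bar> powr p" "h n"] by (simp add: add.commute)
      finally show "norm (\<integral>t. \<bar>f \<omega> (t + h n) - f \<omega> t\<bar> powr p \<partial>lborel)
        \<le> 2 powr p * (2 * (\<integral>t. \<bar>f \<omega> t\<bar> powr p \<partial>lborel))" by simp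
    qed
    show "(\<lambda>\<omega>. \<integral>t. \<bar>f \<omega> (t + h n) - f \<omega> t\<bar> powr p \<partial>lborel) \<in> borel_measurable M" for n
      unfolding f_def by measurable
  qed simp
  then have lim: "(\<lambda>n. expectation (\<lambda>\<omega>. \<integral>t. \<bar>f \<omega> (t + h n) - f \<omega> t\<bar> powr p \<partial>lborel)) \<longlonglongrightarrow> 0"
    by simp
  \<comment> \<open>For \<open>t\<close> in \<open>[0, 1]\<close> the cut-off is invisible; all
    other times only contribute nonnegative terms, hence an inequality.\<close>
  have bound: "incr_moment c \<le> expectation (\<lambda>\<omega>. \<integral>t. \<bar>f \<omega> (t + c) - f \<omega> t\<bar> powr p \<partial>lborel)"
    if c: "\<bar>c\<bar> \<le> 1" for c
  proof -
    have fst_int: "integrable lborel (\<lambda>t. expectation (\<lambda>\<omega>. \<bar>f \<omega> (t + c) - f \<omega> t\<bar> powr p))"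
      using P.integrable_fst[OF d_int] .
    have "incr_moment c = (\<integral>t. indicator {0..1::real} t * incr_moment c \<partial>lborel)"
      by simp
    also have "\<dots> \<le> (\<integral>t. expectation (\<lambda>\<omega>. \<bar>f \<omega> (t + c) - f \<omega> t\<bar> powr p) \<partial>lborel)"
    proof (intro integral_mono fst_int)
      fix t :: real
      show "indicator {0..1} t * incr_moment c \<le> expectation (\<lambda>\<omega>. \<bar>f \<omega> (t + c) - f \<omega> t\<bar> powr p)"
      proof (cases "t \<in> {0..1}")
        case True
        then have "f \<omega> (t + c) - f \<omega> t = N (t + c) \<omega> - N t \<omega>" for \<omega>
          using c by (auto simp: f_def indicator_def)
        then show ?thesis using increment_moment[of "t + c" t] True by simp
      qed simp
    qed simp
    also have "\<dots> = expectation (\<lambda>\<omega>. \<integral>t. \<bar>f \<omega> (t + c) - f \<omega> t\<bar> powr p \<partial>lborel)"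
      using P.Fubini_integral[OF d_int] by simp
    finally show ?thesis .
  qed
  have "\<forall>\<^sub>F n in sequentially. \<bar>h n\<bar> < 1"
    using order_tendstoD(2)[OF tendsto_rabs[OF h], of 1] by simp
  then have "\<forall>\<^sub>F n in sequentially. incr_moment (h n)
      \<le> expectation (\<lambda>\<omega>. \<integral>t. \<bar>f \<omega> (t + h n) - f \<omega> t\<bar> powr p \<partial>lborel)"
    by eventually_elim (simp add: bound)
  then have "(\<lambda>n. incr_moment (h n)) \<longlonglongrightarrow> 0"
    by (intro tendsto_sandwich[OF _ _ tendsto_const lim]) (auto simp: incr_moment_nonneg)
  then show "(incr_moment \<circ> h) \<longlonglongrightarrow> incr_moment 0"
    by (simp add: comp_def)
qed

end

subsection \<open>The Langevin equation along a path\<close>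

definition exp_measure :: "real \<Rightarrow> real measure" where
  "exp_measure l = density lborel (\<lambda>u. ennreal (exponential_density l u))"

lemma sets_exp_measure [simp, measurable_cong]: "sets (exp_measure l) = sets borel"
  by (simp add: exp_measure_def)

lemma space_exp_measure [simp]: "space (exp_measure l) = UNIV"
  by (simp add: exp_measure_def)

lemma prob_space_exp_measure: "0 < l \<Longrightarrow> prob_space (exp_measure l)"
  unfolding exp_measure_def by (rule prob_space_exponential_density)

lemma exponential_density_nonneg: "0 < l \<Longrightarrow> 0 \<le> exponential_density l u"
  by (simp add: exponential_density_def)

lemma integrable_exp_measure_iff:
  fixes g :: "real \<Rightarrow> real"
  assumes "0 < l" and [measurable]: "g \<in> borel_measurable borel"
  shows "integrable (exp_measure l) g \<longleftrightarrow> integrable lborel (\<lambda>u. exponential_density l u * g u)"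
  unfolding exp_measure_def using assms(1)
  by (subst integrable_density) (auto simp: exponential_density_nonneg)

lemma integral_exp_measure:
  fixes g :: "real \<Rightarrow> real"
  assumes "0 < l" and [measurable]: "g \<in> borel_measurable borel"
  shows "(\<integral>u. g u \<partial>exp_measure l) = (\<integral>u. exponential_density l u * g u \<partial>lborel)"
  unfolding exp_measure_def using assms(1)
  by (subst integral_density) (auto simp: exponential_density_nonneg)

text \<open>Exponential tilting: multiplying the density of rate \<open>l\<close> by
  \<open>exp (c * u)\<close> gives \<open>l / (l - c)\<close> times the density of rate
  \<open>l - c\<close>. Negative \<open>u\<close> carry no mass.\<close>

lemma exp_measure_integrable_exp:
  assumes "0 \<le> c" "c < l"
  shows "integrable (exp_measure l) (\<lambda>u. exp (c * \<bar>u\<bar>))"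
proof -
  have "0 < l - c" using assms by simp
  interpret P: prob_space "exp_measure (l - c)"
    using \<open>0 < l - c\<close> by (rule prob_space_exp_measure)
  have "integrable (exp_measure (l - c)) (\<lambda>_. 1 :: real)" by simp
  then have "integrable lborel (exponential_density (l - c))"
    using integrable_exp_measure_iff[OF \<open>0 < l - c\<close>, of "\<lambda>_. 1"] by simp
  then have "integrable lborel (\<lambda>u. l / (l - c) * exponential_density (l - c) u)"
    by (rule integrable_mult_right)
  also have "(\<lambda>u. l / (l - c) * exponential_density (l - c) u)
      = (\<lambda>u. exponential_density l u * exp (c * \<bar>u\<bar>))"
  proof
    fix u
    have "exp (- u * (l - c)) = exp (- u * l) * exp (c * u)"
      by (simp add: algebra_simps flip: exp_add)
    then show "l / (l - c) * exponential_density (l - c) u = exponential_density l u * exp (c * \<bar>u\<bar>)"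
      using assms by (simp add: exponential_density_def)
  qed
  finally show ?thesis
    using assms by (subst integrable_exp_measure_iff) auto
qed

context
  fixes l t :: real and g :: "real \<Rightarrow> real"
  assumes l: "0 < l" and g [measurable]: "g \<in> borel_measurable borel"
begin

private definition kern :: "real \<Rightarrow> real" where
  "kern s = exponential_density l (t - s) * g s"

private lemma kern_eq: "kern s = l * exp (- l * t) * (indicator {..t} s * (exp (l * s) * g s))"
  by (auto simp: kern_def exponential_density_def indicator_def algebra_simps simp flip: exp_add)

lemma set_integrable_iff_exp_measure:
  "set_integrable lborel {..t} (\<lambda>s. exp (l * s) * g s) \<longleftrightarrow> integrable (exp_measure l) (\<lambda>u. g (t - u))"
proof -
  have "integrable (exp_measure l) (\<lambda>u. g (t - u)) \<longleftrightarrow> integrable lborel (\<lambda>u. kern (t + (- 1) * u))"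
    using l by (subst integrable_exp_measure_iff) (auto simp: kern_def)
  also have "\<dots> \<longleftrightarrow> integrable lborel kern"
    by (rule lborel_integrable_real_affine_iff) simp
  also have "\<dots> \<longleftrightarrow> set_integrable lborel {..t} (\<lambda>s. exp (l * s) * g s)"
    using l unfolding kern_eq set_integrable_def by simp
  finally show ?thesis ..
qed

text \<open>If the integrand is not integrable, both sides take the default value 0. The identity
  thus covers every measurable path, including those in the exceptional null set, and measurability
  of \<open>X\<close> can be read off it.\<close>

lemma set_integral_eq_exp_measure:
  "l * exp (- l * t) * (LBINT s:{..t}. exp (l * s) * g s) = (\<integral>u. g (t - u) \<partial>exp_measure l)"
proof -
  have "(\<integral>u. g (t - u) \<partial>exp_measure l) = (\<integral>u. kern (t + (- 1) * u) \<partial>lborel)"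
    using l by (subst integral_exp_measure) (auto simp: kern_def)
  also have "\<dots> = (\<integral>s. kern s \<partial>lborel)"
    using lborel_integral_real_affine[of "- 1" kern t] by simp
  also have "\<dots> = l * exp (- l * t) * (LBINT s:{..t}. exp (l * s) * g s)"
    unfolding kern_eq set_lebesgue_integral_def by simp
  finally show ?thesis ..
qed

end

lemma
  fixes l u b :: real
  assumes "u \<le> b"
  shows integrable_exp_Icc: "integrable lborel (\<lambda>s. indicator {u..b} s * (l * exp (- l * s)))"
    and integral_exp_Icc: "(\<integral>s. indicator {u..b} s * (l * exp (- l * s)) \<partial>lborel) = exp (- l * u) - exp (- l * b)"
proof -
  have "has_bochner_integral lborel (\<lambda>s. (l * exp (- l * s)) * indicator {u..b} s)
      ((- exp (- l * b)) - (- exp (- l * u)))"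
    using assms
    by (intro has_bochner_integral_FTC_Icc_real) (auto intro!: derivative_eq_intros)
  then show "integrable lborel (\<lambda>s. indicator {u..b} s * (l * exp (- l * s)))"
    "(\<integral>s. indicator {u..b} s * (l * exp (- l * s)) \<partial>lborel) = exp (- l * u) - exp (- l * b)"
    by (auto simp: has_bochner_integral_iff mult.commute)
qed

section \<open>The integral formula solves the equation along a single path\<close>

context
  fixes l :: real and g x :: "real \<Rightarrow> real"
  assumes l: "0 < l" and g [measurable]: "g \<in> borel_measurable borel"
    and int: "\<And>t. set_integrable lborel {..t} (\<lambda>s. exp (l * s) * g s)"
    and x: "\<And>t. x t = g t - l * exp (- l * t) * (LBINT s:{..t}. exp (l * s) * g s)"
begin

text \<open>With the weighted path \<open>k\<close> and its integral \<open>G\<close> from minus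
  infinity, \<open>x t = g t - l * exp (- l * t) * G t\<close>.\<close>

private definition k :: "real \<Rightarrow> real" where "k s = exp (l * s) * g s"
private definition G :: "real \<Rightarrow> real" where "G t = (LBINT s:{..t}. k s)"

private lemma exp_l_k: "exp (- l * u) * k u = g u"
  by (simp add: k_def flip: mult.assoc exp_add)

private lemma k_measurable [measurable]: "k \<in> borel_measurable borel"
  unfolding k_def by measurable

private lemma int_k: "set_integrable lborel {..t} k"
  using int[of t] by (simp add: k_def[abs_def])

private lemma int_k_Icc: "integrable lborel (\<lambda>s. indicator {a..b} s * k s)"
  using set_integrable_subset[OF int_k[of b], of "{a..b}"] by (simp add: set_integrable_def)

text \<open>On \<open>{a..b}\<close> the weight \<open>exp (l * s)\<close> is at least
  \<open>exp (l * a)\<close>, so local integrability passes from \<open>k\<close> to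
  \<open>g\<close>.\<close>

private lemma g_Icc: "integrable lborel (\<lambda>s. indicator {a..b} s * g s)"
proof (rule Bochner_Integration.integrable_bound)
  show "integrable lborel (\<lambda>s. exp (- l * a) * (indicator {a..b} s * k s))"
    by (intro integrable_mult_right int_k_Icc)
  have "\<bar>g s\<bar> \<le> exp (- l * a) * \<bar>k s\<bar>" if "a \<le> s" for s
  proof -
    have "1 \<le> exp (- l * a + l * s)"
      using l that by simp
    then have "1 * \<bar>g s\<bar> \<le> exp (- l * a + l * s) * \<bar>g s\<bar>"
      by (rule mult_right_mono) simp
    then show ?thesis
      by (simp only: k_def abs_mult exp_add abs_exp_cancel mult.assoc mult_1)
  qed
  then show "AE s in lborel. norm (indicator {a..b} s * g s) \<le> norm (exp (- l * a) * (indicator {a..b} s * k s))"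
    by (intro AE_I2) (auto simp: indicator_def abs_mult)
qed measurable

private lemma G_diff:
  assumes "a \<le> t"
  shows "(\<integral>s. indicator {a..t} s * k s \<partial>lborel) = G t - G a"
proof -
  have "G t = (LBINT s:{..a}. k s) + (LBINT s:{a<..t}. k s)"
    unfolding G_def using assms
    by (subst set_integral_Un[symmetric])
       (auto intro!: set_integrable_subset[OF int_k[of t]] simp: ivl_disj_un)
  also have "(LBINT s:{a<..t}. k s) = (LBINT s:{a..t}. k s)"
    by (intro set_integral_discrete_difference[where X = "{a}"]) auto
  finally show ?thesis by (simp add: G_def set_lebesgue_integral_def)
qed

text \<open>Fubini's theorem for \<open>\<phi>\<close> takes the place of integration by parts: \<open>k\<close> is merely integrable, so
  \<open>G\<close> need not be differentiable.\<close>
private definition \<phi> :: "real \<Rightarrow> real \<Rightarrow> real \<Rightarrow> real \<Rightarrow> real" where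
  "\<phi> a b u s = (indicator {a..b} u * k u) * (indicator {u..b} s * (l * exp (- l * s)))"

text \<open>Integrating over \<open>s\<close> leaves \<open>exp (- l * u) - exp (- l * b)\<close>;
  its first term cancels the weight in \<open>k u\<close> and returns \<open>g u\<close>. The other
  order of integration produces \<open>G s - G a\<close> instead.\<close>

private lemma \<phi>_integral:
  "(\<integral>s. \<phi> a b u s \<partial>lborel) = indicator {a..b} u * g u - exp (- l * b) * (indicator {a..b} u * k u)"
proof (cases "u \<le> b")
  case True
  have "(\<integral>s. \<phi> a b u s \<partial>lborel) = (indicator {a..b} u * k u) * (exp (- l * u) - exp (- l * b))"
    by (simp only: \<phi>_def integral_mult_right_zero integral_exp_Icc[OF True])
  then show ?thesis
    using exp_l_k[of u] by (simp add: algebra_simps)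
qed (simp add: \<phi>_def)

private lemma \<phi>_integrable: "integrable (lborel \<Otimes>\<^sub>M lborel) (\<lambda>(u, s). \<phi> a b u s)"
proof (rule lborel_pair.Fubini_integrable)
  show "(\<lambda>(u, s). \<phi> a b u s) \<in> borel_measurable (lborel \<Otimes>\<^sub>M lborel)"
    unfolding \<phi>_def indicator_def atLeastAtMost_iff by measurable
  have norm_\<phi>: "norm (\<phi> a b u s) = indicator {a..b} u * \<bar>k u\<bar> * (indicator {u..b} s * (l * exp (- l * s)))" for u s
    using l by (simp add: \<phi>_def abs_mult)
  have "(\<integral>s. norm (\<phi> a b u s) \<partial>lborel)
      = indicator {a..b} u * \<bar>g u\<bar> - exp (- l * b) * (indicator {a..b} u * \<bar>k u\<bar>)" for u
  proof (cases "u \<le> b")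
    case True
    have "exp (- l * u) * \<bar>k u\<bar> = \<bar>g u\<bar>"
      using exp_l_k[of u] by (metis abs_exp_cancel abs_mult)
    moreover have "(\<integral>s. norm (\<phi> a b u s) \<partial>lborel)
        = (indicator {a..b} u * \<bar>k u\<bar>) * (exp (- l * u) - exp (- l * b))"
      by (simp only: norm_\<phi> integral_mult_right_zero integral_exp_Icc[OF True])
    ultimately show ?thesis by (simp add: algebra_simps)
  qed (simp add: \<phi>_def)
  moreover have "integrable lborel (\<lambda>u. indicator {a..b} u * \<bar>g u\<bar> - exp (- l * b) * (indicator {a..b} u * \<bar>k u\<bar>))"
    using integrable_abs[OF g_Icc[of a b]] integrable_abs[OF int_k_Icc[of a b]]
    by (intro Bochner_Integration.integrable_diff integrable_mult_right) (simp_all add: abs_mult)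
  ultimately show "integrable lborel (\<lambda>u. \<integral>s. norm (case (u, s) of (u, s) \<Rightarrow> \<phi> a b u s) \<partial>lborel)"
    by simp
  show "AE u in lborel. integrable lborel (\<lambda>s. case (u, s) of (u, s) \<Rightarrow> \<phi> a b u s)"
  proof (rule AE_I2)
    fix u
    show "integrable lborel (\<lambda>s. case (u, s) of (u, s) \<Rightarrow> \<phi> a b u s)"
      using integrable_exp_Icc[of u b l] by (cases "u \<le> b") (auto simp: \<phi>_def)
  qed
qed

private lemma
  assumes "a \<le> b"
  shows langevin_integrable_Icc: "set_integrable lborel {a..b} x"
    and langevin_integral_Icc: "l * (LBINT s:{a..b}. x s) = (g b - x b) - (g a - x a)"
proof -
  have \<phi>_int2: "(\<integral>u. \<phi> a b u s \<partial>lborel) = indicator {a..b} s * (l * exp (- l * s)) * (G s - G a)" for s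
  proof (cases "s \<in> {a..b}")
    case True
    have "(\<integral>u. \<phi> a b u s \<partial>lborel) = (\<integral>u. (l * exp (- l * s)) * (indicator {a..s} u * k u) \<partial>lborel)"
      using True by (intro Bochner_Integration.integral_cong refl) (auto simp: \<phi>_def indicator_def)
    also have "\<dots> = l * exp (- l * s) * (G s - G a)"
      using True by (simp add: G_diff)
    finally show ?thesis using True by simp
  next
    case False
    then have "\<phi> a b u s = 0" for u by (auto simp: \<phi>_def indicator_def)
    then show ?thesis using False by simp
  qed
  have int1: "integrable lborel (\<lambda>s. indicator {a..b} s * (l * exp (- l * s)) * (G s - G a))"
    using lborel_pair.integrable_snd[OF \<phi>_integrable[of a b]] by (simp add: \<phi>_int2)
  have int2: "integrable lborel (\<lambda>s. indicator {a..b} s * (l * exp (- l * s)) * G a)"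
    using integrable_exp_Icc[OF assms, of l] by simp
  have x_G: "x t = g t - l * (exp (- l * t) * G t)" for t
    by (simp add: x G_def k_def)
  \<comment> \<open>Fubini's theorem controls \<open>G s - G a\<close> only, so the constant
    \<open>G a\<close> is split off and integrated explicitly.\<close>
  have x_eq: "indicator {a..b} s * x s = indicator {a..b} s * g s
      - (indicator {a..b} s * (l * exp (- l * s)) * (G s - G a) + indicator {a..b} s * (l * exp (- l * s)) * G a)" for s
    by (simp add: x_G right_diff_distrib distrib_left)
  show "set_integrable lborel {a..b} x"
    unfolding set_integrable_def real_scaleR_def x_eq
    by (intro Bochner_Integration.integrable_diff Bochner_Integration.integrable_add g_Icc int1 int2)
  have "(\<integral>s. indicator {a..b} s * (l * exp (- l * s)) * (G s - G a) \<partial>lborel)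
      = (\<integral>u. indicator {a..b} u * g u - exp (- l * b) * (indicator {a..b} u * k u) \<partial>lborel)"
    using lborel_pair.Fubini_integral[OF \<phi>_integrable[of a b]] by (simp add: \<phi>_int2 \<phi>_integral)
  also have "\<dots> = (\<integral>u. indicator {a..b} u * g u \<partial>lborel) - exp (- l * b) * (G b - G a)"
    using g_Icc int_k_Icc assms by (simp add: G_diff)
  finally have "(LBINT s:{a..b}. x s) = exp (- l * b) * (G b - G a) - (exp (- l * a) - exp (- l * b)) * G a"
    unfolding set_lebesgue_integral_def real_scaleR_def x_eq
    using integral_exp_Icc[OF assms, of l] g_Icc[of a b] int1 int2 by simp
  also have "\<dots> = exp (- l * b) * G b - exp (- l * a) * G a"
    by (simp add: algebra_simps)
  finally show "l * (LBINT s:{a..b}. x s) = (g b - x b) - (g a - x a)"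
    by (simp add: x_G[of a] x_G[of b] right_diff_distrib)
qed

lemma langevin_equation:
  shows "interval_lebesgue_integrable lborel (ereal 0) (ereal t) x"
    and "x t = x 0 - l * (LBINT s=ereal 0..ereal t. x s) + (g t - g 0)"
proof -
  have ii: "interval_lebesgue_integrable lborel (ereal a) (ereal b) x" if "a \<le> b" for a b
    using that set_integrable_subset[OF langevin_integrable_Icc[OF that] _ greaterThanLessThan_subseteq_atLeastAtMost_iff[THEN iffD2]]
    by (simp add: interval_lebesgue_integrable_def)
  show "interval_lebesgue_integrable lborel (ereal 0) (ereal t) x"
    using ii[of 0 t] ii[of t 0] interval_integrable_endpoints_reverse by (cases "0 \<le> t") auto
  show "x t = x 0 - l * (LBINT s=ereal 0..ereal t. x s) + (g t - g 0)"
  proof (cases "0 \<le> t")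
    case True
    then show ?thesis
      using langevin_integral_Icc[OF True] by (simp add: interval_integral_Icc)
  next
    case False
    then have "l * (LBINT s=ereal t..ereal 0. x s) = (g 0 - x 0) - (g t - x t)"
      using langevin_integral_Icc[of t 0] by (simp add: interval_integral_Icc)
    then show ?thesis
      by (subst interval_integral_endpoints_reverse) simp
  qed
qed

end

text \<open>Regularity is bootstrapped: the integral \<open>I\<close> of an integrable function is
  continuous, so \<open>d = d 0 - l * I\<close> is continuous, so \<open>I\<close> is
  differentiable. Then \<open>exp (l * t) * d t\<close> has derivative zero.\<close>

lemma homogeneous_langevin_solution:
  fixes d :: "real \<Rightarrow> real"
  assumes int: "\<And>t. 0 \<le> t \<Longrightarrow> interval_lebesgue_integrable lborel (ereal 0) (ereal t) d"
    and eq: "\<And>t. 0 \<le> t \<Longrightarrow> d t = d 0 - l * (LBINT s=ereal 0..ereal t. d s)"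
    and T: "0 \<le> T"
  shows "d T = exp (- l * T) * d 0"
proof -
  have set_int: "set_integrable lborel {0..t} d" if "0 \<le> t" for t
  proof -
    have "set_integrable lborel {0<..<t} d"
      using int[OF that] that by (simp add: interval_lebesgue_integrable_def)
    then show ?thesis
      unfolding set_integrable_def
      by (subst integrable_discrete_difference[where X = "{0, t}" and g = "\<lambda>s. indicator {0<..<t} s *\<^sub>R d s"])
         (auto simp: indicator_def)
  qed
  define I where "I t = integral {0..t} d" for t
  have dI: "d t = d 0 - l * I t" if "t \<in> {0..T}" for t
    using eq[of t] interval_integral_eq_integral[OF _ set_int[of t]] that by (simp add: I_def)
  have "d integrable_on {0..T}"
    using set_borel_integral_eq_integral(1)[OF set_int[OF T]] .
  then have "continuous_on {0..T} I"
    unfolding I_def by (rule indefinite_integral_continuous_1)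
  then have "continuous_on {0..T} (\<lambda>t. d 0 - l * I t)"
    by (intro continuous_intros)
  then have "continuous_on {0..T} d"
    by (rule continuous_on_eq) (rule dI[symmetric])
  then have I_deriv: "(I has_real_derivative d t) (at t within {0..T})" if "t \<in> {0..T}" for t
    unfolding I_def using that by (rule integral_has_real_derivative)
  have deriv: "((\<lambda>t. exp (l * t) * (d 0 - l * I t)) has_field_derivative 0) (at t within {0..T})"
    if t: "t \<in> {0..T}" for t
    by (rule derivative_eq_intros I_deriv[OF t] refl | simp add: dI[OF t])+
  have "\<exists>c. \<forall>t\<in>{0..T}. exp (l * t) * (d 0 - l * I t) = c"
    by (rule has_field_derivative_zero_constant[OF _ deriv]) simp_all
  then obtain c where c: "\<And>t. t \<in> {0..T} \<Longrightarrow> exp (l * t) * (d 0 - l * I t) = c"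
    by blast
  have "I 0 = 0" by (simp add: I_def)
  then have "exp (l * T) * (d 0 - l * I T) = d 0"
    using c[of T] c[of 0] T by simp
  then have "exp (l * T) * d T = d 0"
    using dI[of T] T by simp
  then show ?thesis
    by (simp add: exp_minus field_simps)
qed

subsection \<open>Stationary solutions\<close>

lemma (in prob_space) integrable_of_powr:
  fixes f :: "'a \<Rightarrow> real" and p :: real
  assumes p: "1 \<le> p" and [measurable]: "f \<in> borel_measurable M"
    and int: "integrable M (\<lambda>x. \<bar>f x\<bar> powr p)"
  shows "integrable M f"
proof (rule Bochner_Integration.integrable_bound)
  show "integrable M (\<lambda>x. 1 + \<bar>f x\<bar> powr p)" using int by simp
  show "AE x in M. norm (f x) \<le> norm (1 + \<bar>f x\<bar> powr p)"
    using abs_le_1_plus_powr[OF p] by (intro AE_I2) simp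
qed simp

lemma (in prob_space) powr_abs_expectation_le:
  fixes f :: "'a \<Rightarrow> real" and p :: real
  assumes p: "1 \<le> p" and [measurable]: "f \<in> borel_measurable M"
    and int: "integrable M (\<lambda>x. \<bar>f x\<bar> powr p)"
  shows "\<bar>expectation f\<bar> powr p \<le> expectation (\<lambda>x. \<bar>f x\<bar> powr p)"
  using integrable_of_powr[OF assms] int powr_abs_convex[OF p]
  by (intro jensens_inequality[where I = UNIV]) auto

text \<open>Jensen's inequality under \<open>E\<close> for each fixed \<open>\<omega>\<close>,
  followed by Fubini's theorem: the moment of an average of random variables is at most the average
  of their moments.\<close>

lemma mixture_Lp:
  fixes D :: "'b \<Rightarrow> 'a \<Rightarrow> real" and p :: real
  assumes "prob_space E" "prob_space M" and p: "1 \<le> p"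
    and D [measurable]: "(\<lambda>(u, \<omega>). D u \<omega>) \<in> borel_measurable (E \<Otimes>\<^sub>M M)"
    and int: "integrable (E \<Otimes>\<^sub>M M) (\<lambda>(u, \<omega>). \<bar>D u \<omega>\<bar> powr p)"
  shows mixture_AE_integrable: "AE \<omega> in M. integrable E (\<lambda>u. D u \<omega>)"
    and mixture_integrable: "integrable M (\<lambda>\<omega>. \<bar>\<integral>u. D u \<omega> \<partial>E\<bar> powr p)"
    and mixture_moment_le: "(\<integral>\<omega>. \<bar>\<integral>u. D u \<omega> \<partial>E\<bar> powr p \<partial>M) \<le> (\<integral>u. \<integral>\<omega>. \<bar>D u \<omega>\<bar> powr p \<partial>M \<partial>E)"
proof -
  interpret E: prob_space E by fact
  interpret M: prob_space M by fact
  interpret P: pair_sigma_finite E M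
    by (rule pair_sigma_finite.intro[OF E.sigma_finite_measure_axioms M.sigma_finite_measure_axioms])
  have D_sec: "(\<lambda>u. D u \<omega>) \<in> borel_measurable E" if "\<omega> \<in> space M" for \<omega>
    using measurable_compose[OF measurable_Pair2'[OF that] D] by simp
  have D_swap: "(\<lambda>(\<omega>, u). D u \<omega>) \<in> borel_measurable (M \<Otimes>\<^sub>M E)"
    using measurable_compose[OF measurable_pair_swap' D] by (simp add: case_prod_beta')
  have meas: "(\<lambda>\<omega>. \<bar>\<integral>u. D u \<omega> \<partial>E\<bar> powr p) \<in> borel_measurable M"
    using E.borel_measurable_lebesgue_integral[OF D_swap] by measurable
  have AE_int: "AE \<omega> in M. integrable E (\<lambda>u. \<bar>D u \<omega>\<bar> powr p)"
    by (rule P.AE_integrable_snd[OF int])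
  show "AE \<omega> in M. integrable E (\<lambda>u. D u \<omega>)"
    using AE_int AE_space by eventually_elim (rule E.integrable_of_powr[OF p D_sec])
  have jensen: "AE \<omega> in M. \<bar>\<integral>u. D u \<omega> \<partial>E\<bar> powr p \<le> (\<integral>u. \<bar>D u \<omega>\<bar> powr p \<partial>E)"
    using AE_int AE_space by eventually_elim (rule E.powr_abs_expectation_le[OF p D_sec])
  have int_snd: "integrable M (\<lambda>\<omega>. \<integral>u. \<bar>D u \<omega>\<bar> powr p \<partial>E)"
    by (rule P.integrable_snd[OF int])
  show int_M: "integrable M (\<lambda>\<omega>. \<bar>\<integral>u. D u \<omega> \<partial>E\<bar> powr p)"
    by (rule Bochner_Integration.integrable_bound[OF int_snd meas])
       (use jensen in \<open>auto elim!: eventually_mono\<close>)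
  have "(\<integral>\<omega>. \<bar>\<integral>u. D u \<omega> \<partial>E\<bar> powr p \<partial>M) \<le> (\<integral>\<omega>. \<integral>u. \<bar>D u \<omega>\<bar> powr p \<partial>E \<partial>M)"
    by (rule integral_mono_AE[OF int_M int_snd jensen])
  also have "\<dots> = (\<integral>u. \<integral>\<omega>. \<bar>D u \<omega>\<bar> powr p \<partial>M \<partial>E)"
    by (rule P.Fubini_integral[OF int])
  finally show "(\<integral>\<omega>. \<bar>\<integral>u. D u \<omega> \<partial>E\<bar> powr p \<partial>M) \<le> (\<integral>u. \<integral>\<omega>. \<bar>D u \<omega>\<bar> powr p \<partial>M \<partial>E)" .
qed

section \<open>Existence, moments and continuity of the candidate \<open>X\<close>\<close>

locale langevin_process = stationary_increment_process M N p
  for M :: "'a measure" and N :: "real \<Rightarrow> 'a \<Rightarrow> real" and p :: real +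
  fixes l :: real and X :: "real \<Rightarrow> 'a \<Rightarrow> real"
  assumes l_pos: "0 < l"
    and X_def: "\<And>t \<omega>. X t \<omega> = N t \<omega> - l * exp (- l * t) * (LBINT s:{..t}. exp (l * s) * N s \<omega>)"
begin

abbreviation E :: "real measure" where "E \<equiv> exp_measure l"

sublocale E: prob_space E
  using l_pos by (rule prob_space_exp_measure)

lemma pair_E_M: "pair_sigma_finite E M"
  by (rule pair_sigma_finite.intro[OF E.sigma_finite_measure_axioms sigma_finite_measure_axioms])

lemma X_eq: "\<omega> \<in> space M \<Longrightarrow> X t \<omega> = N t \<omega> - (\<integral>u. N (t - u) \<omega> \<partial>E)"
  using set_integral_eq_exp_measure[OF l_pos path_measurable] by (simp add: X_def)

lemma X_measurable [measurable]: "X t \<in> borel_measurable M"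
proof -
  have "(\<lambda>\<omega>. N t \<omega> - (\<integral>u. N (t - u) \<omega> \<partial>E)) \<in> borel_measurable M"
    by measurable
  then show ?thesis
    by (rule measurable_cong[THEN iffD1, rotated]) (simp add: X_eq)
qed

lemma shifted_N_integrable: "integrable (E \<Otimes>\<^sub>M M) (\<lambda>(u, \<omega>). \<bar>N (t - u) \<omega>\<bar> powr p)"
proof -
  interpret P: pair_sigma_finite E M by (rule pair_E_M)
  \<comment> \<open>A rate below \<open>l\<close> is required so that
    \<open>exp (l / 2 * \<bar>u\<bar>)\<close> is integrable under \<open>E\<close>.\<close>
  have c: "0 < l / 2" using l_pos by simp
  obtain A where A: "0 \<le> A" "\<And>t. expectation (\<lambda>\<omega>. \<bar>N t \<omega>\<bar> powr p) \<le> A * exp (l / 2 * \<bar>t\<bar>)"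
    using moment_growth[OF c] by blast
  show ?thesis
  proof (rule P.Fubini_integrable)
    show "(\<lambda>(u, \<omega>). \<bar>N (t - u) \<omega>\<bar> powr p) \<in> borel_measurable (E \<Otimes>\<^sub>M M)"
      by measurable
    have "integrable E (\<lambda>u. expectation (\<lambda>\<omega>. \<bar>N (t - u) \<omega>\<bar> powr p))"
    proof (rule Bochner_Integration.integrable_bound)
      show "integrable E (\<lambda>u. (A * exp (l / 2 * \<bar>t\<bar>)) * exp (l / 2 * \<bar>u\<bar>))"
        using l_pos by (intro integrable_mult_right exp_measure_integrable_exp) auto
      have exp_le: "A * exp (l / 2 * \<bar>t - u\<bar>) \<le> A * exp (l / 2 * \<bar>t\<bar> + l / 2 * \<bar>u\<bar>)" for u
        using A(1) l_pos abs_triangle_ineq4[of t u]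
        by (intro mult_left_mono) (auto simp flip: distrib_left)
      have "expectation (\<lambda>\<omega>. \<bar>N (t - u) \<omega>\<bar> powr p) \<le> A * exp (l / 2 * \<bar>t\<bar>) * exp (l / 2 * \<bar>u\<bar>)" for u
        using order_trans[OF A(2)[of "t - u"] exp_le] by (simp only: exp_add mult.assoc)
      then show "AE u in E. norm (expectation (\<lambda>\<omega>. \<bar>N (t - u) \<omega>\<bar> powr p))
          \<le> norm (A * exp (l / 2 * \<bar>t\<bar>) * exp (l / 2 * \<bar>u\<bar>))"
        using A(1) by (intro AE_I2) (simp add: abs_mult)
      show "(\<lambda>u. expectation (\<lambda>\<omega>. \<bar>N (t - u) \<omega>\<bar> powr p)) \<in> borel_measurable E"
        by measurable
    qed
    then show "integrable E (\<lambda>u. expectation (\<lambda>\<omega>. norm (case (u, \<omega>) of (u, \<omega>) \<Rightarrow> \<bar>N (t - u) \<omega>\<bar> powr p)))"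
      by simp
    show "AE u in E. integrable M (\<lambda>\<omega>. case (u, \<omega>) of (u, \<omega>) \<Rightarrow> \<bar>N (t - u) \<omega>\<bar> powr p)"
      by (simp add: moment_integrable)
  qed
qed

lemma AE_shifted_N_integrable: "AE \<omega> in M. integrable E (\<lambda>u. N (t - u) \<omega>)"
  by (rule mixture_AE_integrable[OF E.prob_space_axioms prob_space_axioms p_ge_1 _ shifted_N_integrable])
     measurable

text \<open>A single null set has to serve all real \<open>t\<close>: the countably many integer
  endpoints share one, and every \<open>{..t}\<close> lies in some \<open>{..n}\<close>.\<close>

lemma AE_set_integrable: "AE \<omega> in M. \<forall>t. set_integrable lborel {..t} (\<lambda>s. exp (l * s) * N s \<omega>)"
proof -
  have "AE \<omega> in M. \<forall>n::nat. integrable E (\<lambda>u. N (real n - u) \<omega>)"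
    unfolding AE_all_countable using AE_shifted_N_integrable by blast
  then show ?thesis
    using AE_space
  proof eventually_elim
    fix \<omega> assume int: "\<forall>n::nat. integrable E (\<lambda>u. N (real n - u) \<omega>)" and om: "\<omega> \<in> space M"
    show "\<forall>t. set_integrable lborel {..t} (\<lambda>s. exp (l * s) * N s \<omega>)"
    proof
      fix t
      obtain n :: nat where n: "t \<le> real n" using real_arch_simple by blast
      have "set_integrable lborel {..real n} (\<lambda>s. exp (l * s) * N s \<omega>)"
        using int set_integrable_iff_exp_measure[OF l_pos path_measurable[OF om]] by simp
      then show "set_integrable lborel {..t} (\<lambda>s. exp (l * s) * N s \<omega>)"
        by (rule set_integrable_subset) (use n in auto)
    qed
  qed
qed

lemma X_langevin: "AE \<omega> in M. \<forall>t.
    interval_lebesgue_integrable lborel (ereal 0) (ereal t) (\<lambda>s. X s \<omega>) \<and>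
    X t \<omega> = X 0 \<omega> - l * (LBINT s=ereal 0..ereal t. X s \<omega>) + (N t \<omega> - N 0 \<omega>)"
  using AE_set_integrable AE_space
proof eventually_elim
  fix \<omega> assume int: "\<forall>t. set_integrable lborel {..t} (\<lambda>s. exp (l * s) * N s \<omega>)" and om: "\<omega> \<in> space M"
  show "\<forall>t. interval_lebesgue_integrable lborel (ereal 0) (ereal t) (\<lambda>s. X s \<omega>) \<and>
    X t \<omega> = X 0 \<omega> - l * (LBINT s=ereal 0..ereal t. X s \<omega>) + (N t \<omega> - N 0 \<omega>)"
    using langevin_equation[OF l_pos path_measurable[OF om] int[rule_format] X_def] by blast
qed

lemma X_moment_integrable: "integrable M (\<lambda>\<omega>. \<bar>X t \<omega>\<bar> powr p)"
proof (rule Bochner_Integration.integrable_bound)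
  have "integrable M (\<lambda>\<omega>. \<bar>\<integral>u. N (t - u) \<omega> \<partial>E\<bar> powr p)"
    by (rule mixture_integrable[OF E.prob_space_axioms prob_space_axioms p_ge_1 _ shifted_N_integrable])
       measurable
  then show "integrable M (\<lambda>\<omega>. 2 powr p * (\<bar>N t \<omega>\<bar> powr p + \<bar>\<integral>u. N (t - u) \<omega> \<partial>E\<bar> powr p))"
    by (intro integrable_mult_right Bochner_Integration.integrable_add moment_integrable)
  show "AE \<omega> in M. norm (\<bar>X t \<omega>\<bar> powr p)
      \<le> norm (2 powr p * (\<bar>N t \<omega>\<bar> powr p + \<bar>\<integral>u. N (t - u) \<omega> \<partial>E\<bar> powr p))"
    using powr_abs_diff_le[OF p_ge_1] by (intro AE_I2) (simp add: X_eq)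
qed measurable

text \<open>\<open>F\<close> and \<open>F'\<close> are times depending on the delay. They are used
  as \<open>s - u\<close> against \<open>t - u\<close>, with \<open>C = \<bar>s - t\<bar>\<close>,
  and as \<open>t - u\<close> against a discretised \<open>t - F u\<close>, where
  \<open>3 * \<bar>u\<bar>\<close> arises. Growth at rate \<open>l / 6\<close> turns
  \<open>3 * \<bar>u\<bar>\<close> into the integrable
  \<open>exp (l / 2 * \<bar>u\<bar>)\<close>.\<close>

lemma increment_pair_integrable:
  assumes [measurable]: "F \<in> borel_measurable borel" "F' \<in> borel_measurable borel"
    and bound: "\<And>u. \<bar>F u - F' u\<bar> \<le> C + 3 * \<bar>u\<bar>"
  shows "integrable (E \<Otimes>\<^sub>M M) (\<lambda>(u, \<omega>). \<bar>N (F u) \<omega> - N (F' u) \<omega>\<bar> powr p)"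
    and "integrable E (\<lambda>u. incr_moment (F u - F' u))"
proof -
  interpret P: pair_sigma_finite E M by (rule pair_E_M)
  have c: "0 < l / 6" using l_pos by simp
  obtain A where A: "0 \<le> A" "\<And>h. incr_moment h \<le> A * exp (l / 6 * \<bar>h\<bar>)"
    using incr_moment_growth[OF c] by blast
  show int: "integrable E (\<lambda>u. incr_moment (F u - F' u))"
  proof (rule Bochner_Integration.integrable_bound)
    show "integrable E (\<lambda>u. (A * exp (l / 6 * C)) * exp (l / 2 * \<bar>u\<bar>))"
      using l_pos by (intro integrable_mult_right exp_measure_integrable_exp) auto
    show "AE u in E. norm (incr_moment (F u - F' u)) \<le> norm ((A * exp (l / 6 * C)) * exp (l / 2 * \<bar>u\<bar>))"
    proof (rule AE_I2)
      fix u
      have "l / 6 * \<bar>F u - F' u\<bar> \<le> l / 6 * (C + 3 * \<bar>u\<bar>)"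
        using bound[of u] c by (intro mult_left_mono) auto
      also have "\<dots> = l / 6 * C + l / 2 * \<bar>u\<bar>" by (simp add: algebra_simps)
      finally have "A * exp (l / 6 * \<bar>F u - F' u\<bar>) \<le> A * exp (l / 6 * C + l / 2 * \<bar>u\<bar>)"
        using A(1) by (intro mult_left_mono) auto
      then have "incr_moment (F u - F' u) \<le> A * exp (l / 6 * C + l / 2 * \<bar>u\<bar>)"
        using A(2)[of "F u - F' u"] by linarith
      then show "norm (incr_moment (F u - F' u)) \<le> norm ((A * exp (l / 6 * C)) * exp (l / 2 * \<bar>u\<bar>))"
        using A(1) by (simp add: exp_add incr_moment_nonneg mult.assoc)
    qed
  qed measurable
  show "integrable (E \<Otimes>\<^sub>M M) (\<lambda>(u, \<omega>). \<bar>N (F u) \<omega> - N (F' u) \<omega>\<bar> powr p)"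
  proof (rule P.Fubini_integrable)
    show "(\<lambda>(u, \<omega>). \<bar>N (F u) \<omega> - N (F' u) \<omega>\<bar> powr p) \<in> borel_measurable (E \<Otimes>\<^sub>M M)"
      by measurable
    show "integrable E (\<lambda>u. expectation (\<lambda>\<omega>. norm (case (u, \<omega>) of (u, \<omega>) \<Rightarrow> \<bar>N (F u) \<omega> - N (F' u) \<omega>\<bar> powr p)))"
      using int by (simp add: increment_moment)
    show "AE u in E. integrable M (\<lambda>\<omega>. case (u, \<omega>) of (u, \<omega>) \<Rightarrow> \<bar>N (F u) \<omega> - N (F' u) \<omega>\<bar> powr p)"
      by (simp add: increment_integrable)
  qed
qed

lemma mixed_increment_moment_le:
  assumes [measurable]: "F \<in> borel_measurable borel" "F' \<in> borel_measurable borel"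
    and bound: "\<And>u. \<bar>F u - F' u\<bar> \<le> C + 3 * \<bar>u\<bar>"
  shows "integrable M (\<lambda>\<omega>. \<bar>\<integral>u. N (F u) \<omega> - N (F' u) \<omega> \<partial>E\<bar> powr p)"
    and "expectation (\<lambda>\<omega>. \<bar>\<integral>u. N (F u) \<omega> - N (F' u) \<omega> \<partial>E\<bar> powr p) \<le> (\<integral>u. incr_moment (F u - F' u) \<partial>E)"
proof -
  have meas: "(\<lambda>(u, \<omega>). N (F u) \<omega> - N (F' u) \<omega>) \<in> borel_measurable (E \<Otimes>\<^sub>M M)"
    by measurable
  note * = E.prob_space_axioms prob_space_axioms p_ge_1 meas increment_pair_integrable(1)[OF assms]
  show "integrable M (\<lambda>\<omega>. \<bar>\<integral>u. N (F u) \<omega> - N (F' u) \<omega> \<partial>E\<bar> powr p)"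
    by (rule mixture_integrable[OF *])
  show "expectation (\<lambda>\<omega>. \<bar>\<integral>u. N (F u) \<omega> - N (F' u) \<omega> \<partial>E\<bar> powr p) \<le> (\<integral>u. incr_moment (F u - F' u) \<partial>E)"
    using mixture_moment_le[OF *] by (simp add: increment_moment)
qed

text \<open>An increment of \<open>X\<close> is an increment of \<open>N\<close> minus an average of
  delayed increments over the same time difference \<open>s - t\<close>. By stationarity both parts
  are bounded by the same moment, whence the inner factor 2.\<close>

lemma X_increment_moment_le:
  "expectation (\<lambda>\<omega>. \<bar>X s \<omega> - X t \<omega>\<bar> powr p) \<le> 2 powr p * (2 * incr_moment (s - t))"
proof -
  let ?I = "\<lambda>\<omega>. \<integral>u. N (s - u) \<omega> - N (t - u) \<omega> \<partial>E"
  note mix = mixed_increment_moment_le[of "\<lambda>u. s - u" "\<lambda>u. t - u" "\<bar>s - t\<bar>"]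
  have "AE \<omega> in M. \<bar>X s \<omega> - X t \<omega>\<bar> powr p = \<bar>(N s \<omega> - N t \<omega>) - ?I \<omega>\<bar> powr p"
    using AE_shifted_N_integrable[of s] AE_shifted_N_integrable[of t] AE_space
    by eventually_elim (simp add: X_eq algebra_simps)
  then have "expectation (\<lambda>\<omega>. \<bar>X s \<omega> - X t \<omega>\<bar> powr p)
      = expectation (\<lambda>\<omega>. \<bar>(N s \<omega> - N t \<omega>) - ?I \<omega>\<bar> powr p)"
    by (intro integral_cong_AE) measurable
  also have "\<dots> \<le> expectation (\<lambda>\<omega>. 2 powr p * (\<bar>N s \<omega> - N t \<omega>\<bar> powr p + \<bar>?I \<omega>\<bar> powr p))"
    using mix(1) increment_integrable powr_abs_diff_le[OF p_ge_1]
    by (intro Bochner_Integration.integral_mono') simp_all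
  also have "\<dots> = 2 powr p * (incr_moment (s - t) + expectation (\<lambda>\<omega>. \<bar>?I \<omega>\<bar> powr p))"
    using mix(1) increment_integrable by (simp add: increment_moment)
  also have "\<dots> \<le> 2 powr p * (incr_moment (s - t) + incr_moment (s - t))"
    using mix(2) E.prob_space by (intro mult_left_mono add_left_mono) simp_all
  finally show ?thesis by simp
qed

lemma X_continuous_in_Lp: "continuous_in_Lp M p X"
  unfolding continuous_in_Lp_def
proof
  fix t :: real
  have "((\<lambda>s. s - t) \<longlongrightarrow> 0) (at t)"
    using tendsto_diff[OF tendsto_ident_at[of t UNIV] tendsto_const[of t "at t"]] by simp
  then have "((\<lambda>s. incr_moment (s - t)) \<longlongrightarrow> incr_moment 0) (at t)"
    by (rule isCont_tendsto_compose[OF incr_moment_isCont_0])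
  then have "((\<lambda>s. 2 powr p * (2 * incr_moment (s - t))) \<longlongrightarrow> 0) (at t)"
    by (auto intro!: tendsto_eq_intros)
  then have "((\<lambda>s. expectation (\<lambda>\<omega>. \<bar>X s \<omega> - X t \<omega>\<bar> powr p)) \<longlongrightarrow> 0) (at t)"
    by (rule tendsto_sandwich[OF _ _ tendsto_const, rotated 2])
       (simp_all add: X_increment_moment_le)
  then show "((\<lambda>s. Lp_norm M p (\<lambda>\<omega>. X s \<omega> - X t \<omega>)) \<longlongrightarrow> 0) (at t)"
    unfolding Lp_norm_def using p_ge_1
    by (intro tendsto_zero_powrI[OF _ tendsto_const]) auto
qed

end

section \<open>Shift invariance of the law of \<open>X\<close> through discretised delays\<close>

lemma (in prob_space) integral_finite_range:
  fixes F :: "'a \<Rightarrow> real" and h :: "real \<Rightarrow> real"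
  assumes [measurable]: "F \<in> borel_measurable M" and fin: "finite (F ` space M)"
  shows integrable_finite_range: "integrable M (\<lambda>u. h (F u))"
    and "expectation (\<lambda>u. h (F u)) = (\<Sum>v\<in>F ` space M. prob {u\<in>space M. F u = v} * h v)"
proof -
  have *: "h (F u) = (\<Sum>v\<in>F ` space M. indicator {u\<in>space M. F u = v} u * h v)" if "u \<in> space M" for u
  proof -
    have "(\<Sum>v\<in>F ` space M. indicator {u\<in>space M. F u = v} u * h v) = (\<Sum>v\<in>F ` space M. if v = F u then h v else 0)"
      using that by (intro sum.cong) (auto simp: indicator_def)
    then show ?thesis using fin that by simp
  qed
  have int: "integrable M (\<lambda>u. indicator {u\<in>space M. F u = v} u * h v)" for v
    by (intro integrable_mult_left integrable_real_indicator) (auto simp: less_top[symmetric])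
  have "integrable M (\<lambda>u. \<Sum>v\<in>F ` space M. indicator {u\<in>space M. F u = v} u * h v)"
    by (intro Bochner_Integration.integrable_sum int)
  then show "integrable M (\<lambda>u. h (F u))"
    by (rule Bochner_Integration.integrable_cong[THEN iffD2, rotated -1]) (auto simp: *)
  have "expectation (\<lambda>u. h (F u)) = expectation (\<lambda>u. \<Sum>v\<in>F ` space M. indicator {u\<in>space M. F u = v} u * h v)"
    by (intro Bochner_Integration.integral_cong refl *)
  also have "\<dots> = (\<Sum>v\<in>F ` space M. expectation (\<lambda>u. indicator {u\<in>space M. F u = v} u * h v))"
    by (intro Bochner_Integration.integral_sum int)
  also have "\<dots> = (\<Sum>v\<in>F ` space M. prob {u\<in>space M. F u = v} * h v)"
    by (intro sum.cong refl) (simp add: Int_def conj_ac)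
  finally show "expectation (\<lambda>u. h (F u)) = (\<Sum>v\<in>F ` space M. prob {u\<in>space M. F u = v} * h v)" .
qed

text \<open>The sums at times in \<open>J\<close> are a fixed measurable function
  \<open>\<Phi>\<close> of the process at the finitely many times in \<open>K\<close>, so their law
  is an image of the law over \<open>K\<close>.\<close>

lemma equal_in_law_increment_sum:
  assumes Z: "\<And>t. Z t \<in> borel_measurable M" and Z': "\<And>t. Z' t \<in> borel_measurable M"
    and law: "equal_in_law M Z Z'" and R: "finite R"
  shows "equal_in_law M (\<lambda>t \<omega>. \<Sum>v\<in>R. w v * (Z t \<omega> - Z (t - v) \<omega>))
    (\<lambda>t \<omega>. \<Sum>v\<in>R. w v * (Z' t \<omega> - Z' (t - v) \<omega>))"
  unfolding equal_in_law_def
proof (intro allI impI)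
  fix J :: "real set" assume J: "finite J"
  define K where "K = J \<union> (\<lambda>(t, v). t - v) ` (J \<times> R)"
  have K: "finite K" "J \<subseteq> K" "\<And>t v. t \<in> J \<Longrightarrow> v \<in> R \<Longrightarrow> t - v \<in> K"
    using J R by (auto simp: K_def)
  define \<Phi> where "\<Phi> x = (\<lambda>t\<in>J. \<Sum>v\<in>R. w v * (x t - x (t - v)))" for x :: "real \<Rightarrow> real"
  have comp: "(\<lambda>x. x t) \<in> borel_measurable (\<Pi>\<^sub>M t\<in>K. (borel :: real measure))" if "t \<in> K" for t
    using that by (rule measurable_component_singleton)
  have \<Phi>_meas: "\<Phi> \<in> measurable (\<Pi>\<^sub>M t\<in>K. borel) (\<Pi>\<^sub>M t\<in>J. borel)"
    unfolding \<Phi>_def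
    by (intro measurable_restrict borel_measurable_sum borel_measurable_times borel_measurable_diff
        borel_measurable_const comp) (use K in auto)
  have fdd_eq: "fdd M (\<lambda>t \<omega>. \<Sum>v\<in>R. w v * (W t \<omega> - W (t - v) \<omega>)) J
      = distr (fdd M W K) (\<Pi>\<^sub>M t\<in>J. borel) \<Phi>"
    if W: "\<And>t. W t \<in> borel_measurable M" for W
  proof -
    have "(\<lambda>\<omega>. \<lambda>t\<in>K. W t \<omega>) \<in> measurable M (\<Pi>\<^sub>M t\<in>K. borel)"
      using W by (intro measurable_restrict)
    then have "distr (fdd M W K) (\<Pi>\<^sub>M t\<in>J. borel) \<Phi> = distr M (\<Pi>\<^sub>M t\<in>J. borel) (\<Phi> \<circ> (\<lambda>\<omega>. \<lambda>t\<in>K. W t \<omega>))"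
      unfolding fdd_def by (rule distr_distr[OF \<Phi>_meas])
    also have "\<Phi> \<circ> (\<lambda>\<omega>. \<lambda>t\<in>K. W t \<omega>) = (\<lambda>\<omega>. \<lambda>t\<in>J. \<Sum>v\<in>R. w v * (W t \<omega> - W (t - v) \<omega>))"
      using K by (auto simp: \<Phi>_def fun_eq_iff restrict_def subset_eq intro!: sum.cong)
    finally show ?thesis by (subst fdd_def) (rule sym)
  qed
  have "fdd M Z K = fdd M Z' K"
    using law K(1) by (simp add: equal_in_law_def)
  then show "fdd M (\<lambda>t \<omega>. \<Sum>v\<in>R. w v * (Z t \<omega> - Z (t - v) \<omega>)) J
      = fdd M (\<lambda>t \<omega>. \<Sum>v\<in>R. w v * (Z' t \<omega> - Z' (t - v) \<omega>)) J"
    by (simp add: fdd_eq Z Z')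
qed

context langevin_process
begin

text \<open>With \<open>F\<close> the identity this is almost surely \<open>X\<close>, written with
  increments of \<open>N\<close> only; a finite range of \<open>F\<close> makes it a finite
  sum.\<close>

definition approx :: "(real \<Rightarrow> real) \<Rightarrow> real \<Rightarrow> 'a \<Rightarrow> real" where
  "approx F t \<omega> = (\<integral>u. N t \<omega> - N (t - F u) \<omega> \<partial>E)"

lemma approx_measurable:
  assumes [measurable]: "F \<in> borel_measurable borel"
  shows "approx F t \<in> borel_measurable M"
  unfolding approx_def[abs_def] by measurable

text \<open>Stationarity of increments concerns \<open>N\<close> recentred at 0 and at
  \<open>s\<close>; the recentring terms cancel in every difference
  \<open>N t - N (t - v)\<close>.\<close>

lemma approx_stationary:
  assumes F: "F \<in> borel_measurable borel" "finite (range F)"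
  shows "equal_in_law M (approx F) (\<lambda>t. approx F (t + s))"
proof -
  define w where "w v = E.prob {u\<in>space E. F u = v}" for v
  have approx_eq: "approx F t \<omega> = (\<Sum>v\<in>range F. w v * (N t \<omega> - N (t - v) \<omega>))" for t \<omega>
    using E.integral_finite_range(2)[of F "\<lambda>v. N t \<omega> - N (t - v) \<omega>"] F
    by (simp add: approx_def w_def)
  have "equal_in_law M (\<lambda>t \<omega>. N t \<omega> - N 0 \<omega>) (\<lambda>t \<omega>. N (t + s) \<omega> - N s \<omega>)"
    using stationary_increments by (simp add: stationary_increments_def)
  from equal_in_law_increment_sum[OF _ _ this F(2), of w]
  have "equal_in_law M (\<lambda>t \<omega>. \<Sum>v\<in>range F. w v * (N t \<omega> - N 0 \<omega> - (N (t - v) \<omega> - N 0 \<omega>)))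
      (\<lambda>t \<omega>. \<Sum>v\<in>range F. w v * (N (t + s) \<omega> - N s \<omega> - (N (t - v + s) \<omega> - N s \<omega>)))"
    by simp
  also have "(\<lambda>t \<omega>. \<Sum>v\<in>range F. w v * (N t \<omega> - N 0 \<omega> - (N (t - v) \<omega> - N 0 \<omega>))) = approx F"
    by (simp add: approx_eq fun_eq_iff)
  also have "(\<lambda>t \<omega>. \<Sum>v\<in>range F. w v * (N (t + s) \<omega> - N s \<omega> - (N (t - v + s) \<omega> - N s \<omega>)))
      = (\<lambda>t. approx F (t + s))"
    by (simp add: approx_eq fun_eq_iff algebra_simps)
  finally show ?thesis .
qed

text \<open>The terms \<open>N t\<close> cancel. What remains is an average of increments between
  \<open>t - F u\<close> and \<open>t - u\<close>, to which the mixture bound applies.\<close>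

lemma approx_diff_moment_le:
  assumes F: "F \<in> borel_measurable borel" "finite (range F)" "\<And>u. \<bar>F u\<bar> \<le> 2 * \<bar>u\<bar>"
  shows "integrable M (\<lambda>\<omega>. \<bar>approx F t \<omega> - X t \<omega>\<bar> powr p)"
    and "expectation (\<lambda>\<omega>. \<bar>approx F t \<omega> - X t \<omega>\<bar> powr p) \<le> (\<integral>u. incr_moment (F u - u) \<partial>E)"
proof -
  have [measurable]: "F \<in> borel_measurable borel" by fact
  note [measurable] = approx_measurable[OF F(1)]
  let ?I = "\<lambda>\<omega>. \<integral>u. N (t - u) \<omega> - N (t - F u) \<omega> \<partial>E"
  have "\<bar>(t - u) - (t - F u)\<bar> \<le> 0 + 3 * \<bar>u\<bar>" for u
    using F(3)[of u] by linarith
  note mix = mixed_increment_moment_le[OF _ _ this]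
  have AE: "AE \<omega> in M. \<bar>approx F t \<omega> - X t \<omega>\<bar> powr p = \<bar>?I \<omega>\<bar> powr p"
    using AE_shifted_N_integrable[of t] AE_space
  proof eventually_elim
    fix \<omega> assume int: "integrable E (\<lambda>u. N (t - u) \<omega>)" and om: "\<omega> \<in> space M"
    have intF: "integrable E (\<lambda>u. N (t - F u) \<omega>)"
      using E.integrable_finite_range[of F "\<lambda>v. N (t - v) \<omega>"] F by simp
    have "approx F t \<omega> = N t \<omega> - (\<integral>u. N (t - F u) \<omega> \<partial>E)"
      using intF E.prob_space by (simp add: approx_def)
    then have "approx F t \<omega> - X t \<omega> = ?I \<omega>"
      using int intF om by (simp add: X_eq)
    then show "\<bar>approx F t \<omega> - X t \<omega>\<bar> powr p = \<bar>?I \<omega>\<bar> powr p" by simp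
  qed
  show "integrable M (\<lambda>\<omega>. \<bar>approx F t \<omega> - X t \<omega>\<bar> powr p)"
    using mix(1) by (subst integrable_cong_AE[OF _ _ AE]) simp_all
  have "expectation (\<lambda>\<omega>. \<bar>approx F t \<omega> - X t \<omega>\<bar> powr p) = expectation (\<lambda>\<omega>. \<bar>?I \<omega>\<bar> powr p)"
    by (rule integral_cong_AE[OF _ _ AE]) measurable
  also have "\<dots> \<le> (\<integral>u. incr_moment (F u - u) \<partial>E)"
    using mix(2) by simp
  finally show "expectation (\<lambda>\<omega>. \<bar>approx F t \<omega> - X t \<omega>\<bar> powr p) \<le> (\<integral>u. incr_moment (F u - u) \<partial>E)" .
qed

lemma incr_moment_dominated_tendsto_0:
  assumes F [measurable]: "\<And>k. F k \<in> borel_measurable borel" and bound: "\<And>k u. \<bar>F k u\<bar> \<le> 2 * \<bar>u\<bar>"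
    and lim: "\<And>u. (\<lambda>k. F k u) \<longlonglongrightarrow> u"
  shows "(\<lambda>k::nat. \<integral>u. incr_moment (F k u - u) \<partial>E) \<longlonglongrightarrow> 0"
proof -
  have c: "0 < l / 6" using l_pos by simp
  obtain A where A: "0 \<le> A" "\<And>h. incr_moment h \<le> A * exp (l / 6 * \<bar>h\<bar>)"
    using incr_moment_growth[OF c] by blast
  have "(\<lambda>k. \<integral>u. incr_moment (F k u - u) \<partial>E) \<longlonglongrightarrow> (\<integral>u. 0 \<partial>E)"
  proof (rule integral_dominated_convergence[where w = "\<lambda>u. A * exp (l / 2 * \<bar>u\<bar>)"])
    show "integrable E (\<lambda>u. A * exp (l / 2 * \<bar>u\<bar>))"
      using l_pos by (intro integrable_mult_right exp_measure_integrable_exp) auto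
    show "AE u in E. norm (incr_moment (F k u - u)) \<le> A * exp (l / 2 * \<bar>u\<bar>)" for k
    proof (rule AE_I2)
      fix u
      have "l / 6 * \<bar>F k u - u\<bar> \<le> l / 6 * (3 * \<bar>u\<bar>)"
        using bound[of k u] c by (intro mult_left_mono) auto
      then have "A * exp (l / 6 * \<bar>F k u - u\<bar>) \<le> A * exp (l / 2 * \<bar>u\<bar>)"
        using A(1) by (intro mult_left_mono) auto
      then show "norm (incr_moment (F k u - u)) \<le> A * exp (l / 2 * \<bar>u\<bar>)"
        using A(2)[of "F k u - u"] by (simp add: incr_moment_nonneg)
    qed
    show "AE u in E. (\<lambda>k. incr_moment (F k u - u)) \<longlonglongrightarrow> 0"
    proof (rule AE_I2)
      fix u
      have "(\<lambda>k. F k u - u) \<longlonglongrightarrow> 0"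
        using tendsto_diff[OF lim[of u] tendsto_const[of u]] by simp
      from isCont_tendsto_compose[OF incr_moment_isCont_0 this]
      show "(\<lambda>k. incr_moment (F k u - u)) \<longlonglongrightarrow> 0" by simp
    qed
  qed measurable
  then show ?thesis by simp
qed

text \<open>Replacing the delay \<open>u\<close> by a simple function of \<open>u\<close> turns \<open>X\<close> into a finite combination of
  increments of \<open>N\<close>, whose law is shift invariant; the error vanishes in \<open>L\<^sup>1\<close>.\<close>
lemma X_shift_equal_in_law:
  assumes p: "p = 1"
  shows "equal_in_law M X (\<lambda>t. X (t + s))"
  unfolding equal_in_law_def
proof (intro allI impI fdd_eqI_test_expectation)
  fix J :: "real set" and m :: nat and a :: "real \<Rightarrow> real"
  assume J: "finite J"
  \<comment> \<open>Simple functions tending to the identity. The factor 2 comes with this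
    construction, based at the point 0, and is the source of \<open>3 * \<bar>u\<bar>\<close> in the
    integrability bounds.\<close>
  obtain F :: "nat \<Rightarrow> real \<Rightarrow> real" where F: "\<And>k. simple_function E (F k)"
    "\<And>u. (\<lambda>k. F k u) \<longlonglongrightarrow> u" "\<And>k u. \<bar>F k u\<bar> \<le> 2 * \<bar>u\<bar>"
    using borel_measurable_implies_sequence_metric[of "\<lambda>u. u" E 0] by (auto simp: dist_real_def)
  have F_meas: "F k \<in> borel_measurable borel" for k
    using borel_measurable_simple_function[OF F(1)] by simp
  have F_fin: "finite (range (F k))" for k
    using simple_functionD(1)[OF F(1)] by simp
  note [measurable] = approx_measurable[OF F_meas]
  have conv: "(\<lambda>k. expectation (\<lambda>\<omega>. min 1 \<bar>approx (F k) t \<omega> - X t \<omega>\<bar>)) \<longlonglongrightarrow> 0" for t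
  proof (rule tendsto_sandwich[OF _ _ tendsto_const])
    show "(\<lambda>k. \<integral>u. incr_moment (F k u - u) \<partial>E) \<longlonglongrightarrow> 0"
      by (rule incr_moment_dominated_tendsto_0[OF F_meas F(3) F(2)])
    have min_le: "expectation (\<lambda>\<omega>. min 1 \<bar>approx (F k) t \<omega> - X t \<omega>\<bar>)
        \<le> expectation (\<lambda>\<omega>. \<bar>approx (F k) t \<omega> - X t \<omega>\<bar> powr p)" for k
      using approx_diff_moment_le(1)[OF F_meas F_fin F(3)]
      by (intro Bochner_Integration.integral_mono') (auto simp: p)
    show "\<forall>\<^sub>F k in sequentially. expectation (\<lambda>\<omega>. min 1 \<bar>approx (F k) t \<omega> - X t \<omega>\<bar>)
        \<le> (\<integral>u. incr_moment (F k u - u) \<partial>E)"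
      by (intro always_eventually allI order_trans[OF min_le approx_diff_moment_le(2)[OF F_meas F_fin F(3)]])
  qed simp
  have "(\<lambda>k. test_expectation J m a (approx (F k)) - test_expectation J m a X) \<longlonglongrightarrow> 0"
    by (intro test_expectation_diff_tendsto_0 conv) measurable
  moreover have "(\<lambda>k. test_expectation J m a (\<lambda>t. approx (F k) (t + s))
      - test_expectation J m a (\<lambda>t. X (t + s))) \<longlonglongrightarrow> 0"
    by (intro test_expectation_diff_tendsto_0 conv) measurable
  moreover have shift: "test_expectation J m a (\<lambda>t. approx (F k) (t + s)) = test_expectation J m a (approx (F k))" for k
    using approx_stationary[OF F_meas F_fin, of k s] J
    by (intro test_expectation_cong_law[symmetric]) (auto simp: equal_in_law_def)
  \<comment> \<open>The contributions of \<open>approx (F k)\<close> agree before and after the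
    shift, so subtracting the two null sequences leaves one that is constant in
    \<open>k\<close>.\<close>
  ultimately have "(\<lambda>k. test_expectation J m a (\<lambda>t. X (t + s)) - test_expectation J m a X) \<longlonglongrightarrow> 0"
    using tendsto_diff[of "\<lambda>k. test_expectation J m a (approx (F k)) - test_expectation J m a X" 0 sequentially
        "\<lambda>k. test_expectation J m a (approx (F k)) - test_expectation J m a (\<lambda>t. X (t + s))" 0]
    by (simp only: shift diff_diff_eq2 diff_add_cancel diff_diff_eq) simp
  then show "test_expectation J m a X = test_expectation J m a (\<lambda>t. X (t + s))"
    by (simp add: LIMSEQ_const_iff)
qed (auto)

lemma X_QOU: "p = 1 \<Longrightarrow> QOU_process M N l X"
  unfolding QOU_process_def stationary_process_def stochastic_process_def
  by (intro conjI allI X_measurable X_shift_equal_in_law X_langevin)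

section \<open>Uniqueness in law\<close>

lemma QOU_difference_decay:
  assumes Y: "QOU_process M N l Y"
  shows "AE \<omega> in M. \<forall>t\<ge>0. Y t \<omega> - X t \<omega> = exp (- l * t) * (Y 0 \<omega> - X 0 \<omega>)"
proof -
  have "AE \<omega> in M. \<forall>t. interval_lebesgue_integrable lborel (ereal 0) (ereal t) (\<lambda>s. Y s \<omega>) \<and>
      Y t \<omega> = Y 0 \<omega> - l * (LBINT s=ereal 0..ereal t. Y s \<omega>) + (N t \<omega> - N 0 \<omega>)"
    using Y unfolding QOU_process_def by (rule conjunct2)
  with X_langevin show ?thesis
  proof eventually_elim
    case (elim \<omega>)
    then have int_X: "interval_lebesgue_integrable lborel (ereal 0) (ereal t) (\<lambda>s. X s \<omega>)"
      and int_Y: "interval_lebesgue_integrable lborel (ereal 0) (ereal t) (\<lambda>s. Y s \<omega>)"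
      and X_t: "X t \<omega> = X 0 \<omega> - l * (LBINT s=ereal 0..ereal t. X s \<omega>) + (N t \<omega> - N 0 \<omega>)"
      and Y_t: "Y t \<omega> = Y 0 \<omega> - l * (LBINT s=ereal 0..ereal t. Y s \<omega>) + (N t \<omega> - N 0 \<omega>)" for t
      by blast+
    show ?case
    \<comment> \<open>The driving terms cancel in the difference of the two equations. Both hold for
      all times outside a null set, so \<open>\<omega>\<close> can be kept fixed.\<close>
    proof (intro allI impI homogeneous_langevin_solution[of "\<lambda>t. Y t \<omega> - X t \<omega>" l])
      fix t
      show "interval_lebesgue_integrable lborel (ereal 0) (ereal t) (\<lambda>s. Y s \<omega> - X s \<omega>)"
        by (rule interval_lebesgue_integral_diff(1)[OF int_Y int_X])
      have "(LBINT s=ereal 0..ereal t. Y s \<omega> - X s \<omega>)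
          = (LBINT s=ereal 0..ereal t. Y s \<omega>) - (LBINT s=ereal 0..ereal t. X s \<omega>)"
        by (rule interval_lebesgue_integral_diff(2)[OF int_Y int_X])
      then have "l * (LBINT s=ereal 0..ereal t. Y s \<omega> - X s \<omega>)
          = l * (LBINT s=ereal 0..ereal t. Y s \<omega>) - l * (LBINT s=ereal 0..ereal t. X s \<omega>)"
        by (simp only: right_diff_distrib)
      with X_t[of t] Y_t[of t]
      show "Y t \<omega> - X t \<omega> = Y 0 \<omega> - X 0 \<omega> - l * (LBINT s=ereal 0..ereal t. Y s \<omega> - X s \<omega>)"
        by linarith
    qed
  qed
qed

lemma QOU_difference_tendsto_0:
  assumes Y: "QOU_process M N l Y" and Y_meas [measurable]: "\<And>t. Y t \<in> borel_measurable M"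
  shows "(\<lambda>n. expectation (\<lambda>\<omega>. min 1 \<bar>Y (t + real n) \<omega> - X (t + real n) \<omega>\<bar>)) \<longlonglongrightarrow> 0"
proof -
  have exp_eq: "exp (- l * t) * exp (- l) ^ n = exp (- l * (t + real n))" for n
    unfolding exp_of_nat_mult[symmetric] exp_add[symmetric] by (simp add: algebra_simps)
  have "(\<lambda>n. exp (- l * t) * exp (- l) ^ n) \<longlonglongrightarrow> exp (- l * t) * 0"
    using l_pos by (intro tendsto_mult tendsto_const LIMSEQ_power_zero) simp
  then have exp_lim: "(\<lambda>n. exp (- l * (t + real n))) \<longlonglongrightarrow> 0"
    by (simp only: exp_eq mult_zero_right)
  have "(\<lambda>n. expectation (\<lambda>\<omega>. min 1 \<bar>Y (t + real n) \<omega> - X (t + real n) \<omega>\<bar>)) \<longlonglongrightarrow> expectation (\<lambda>\<omega>. 0 :: real)"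
  proof (rule integral_dominated_convergence[where w = "\<lambda>_. 1"])
    show "AE \<omega> in M. (\<lambda>n. min 1 \<bar>Y (t + real n) \<omega> - X (t + real n) \<omega>\<bar>) \<longlonglongrightarrow> 0"
      using QOU_difference_decay[OF Y]
    proof eventually_elim
      case (elim \<omega>)
      let ?e = "\<lambda>n. \<bar>exp (- l * (t + real n)) * (Y 0 \<omega> - X 0 \<omega>)\<bar>"
      have lim: "?e \<longlonglongrightarrow> 0"
        by (rule tendsto_rabs_zero[OF tendsto_mult_left_zero[OF exp_lim]])
      \<comment> \<open>The decay formula covers nonnegative times, and \<open>t\<close> itself may
        be negative.\<close>
      obtain n0 :: nat where n0: "- t \<le> real n0" using real_arch_simple by blast
      have "\<forall>\<^sub>F n in sequentially. min 1 \<bar>Y (t + real n) \<omega> - X (t + real n) \<omega>\<bar> \<le> ?e n"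
        using eventually_ge_at_top[of n0]
      proof eventually_elim
        fix n assume "n0 \<le> n"
        then have "0 \<le> t + real n" using n0 by linarith
        from elim[rule_format, OF this]
        show "min 1 \<bar>Y (t + real n) \<omega> - X (t + real n) \<omega>\<bar> \<le> ?e n"
          by (simp only: min.cobounded2)
      qed
      then show ?case
        by (intro tendsto_sandwich[OF _ _ tendsto_const lim]) simp_all
    qed
  qed simp_all
  then show ?thesis by simp
qed

text \<open>Shifting time by \<open>n\<close> changes neither test expectation, while their
  difference tends to 0. It is constant in \<open>n\<close>, hence zero.\<close>

lemma QOU_unique:
  assumes p: "p = 1" and Y: "QOU_process M N l Y"
  shows "equal_in_law M Y X"
proof -
  have Y_meas [measurable]: "Y t \<in> borel_measurable M" for t
    using Y by (simp add: QOU_process_def stationary_process_def stochastic_process_def)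
  have Y_law: "equal_in_law M Y (\<lambda>t. Y (t + s))" for s
    using Y by (simp add: QOU_process_def stationary_process_def)
  have "test_expectation J m a Y = test_expectation J m a X" if J: "finite J" for J m a
  proof -
    have "(\<lambda>n. test_expectation J m a (\<lambda>t. Y (t + real n)) - test_expectation J m a (\<lambda>t. X (t + real n))) \<longlonglongrightarrow> 0"
      by (intro test_expectation_diff_tendsto_0 QOU_difference_tendsto_0 Y) measurable
    moreover have "test_expectation J m a (\<lambda>t. Y (t + real n)) = test_expectation J m a Y" for n
      using Y_law[of "real n"] J
      by (intro test_expectation_cong_law[symmetric]) (auto simp: equal_in_law_def)
    moreover have "test_expectation J m a (\<lambda>t. X (t + real n)) = test_expectation J m a X" for n
      using X_shift_equal_in_law[OF p, of "real n"] J
      by (intro test_expectation_cong_law[symmetric]) (auto simp: equal_in_law_def)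
    ultimately show ?thesis
      by (simp add: LIMSEQ_const_iff)
  qed
  then show ?thesis
    unfolding equal_in_law_def by (intro allI impI fdd_eqI_test_expectation) auto
qed

end

theorem theorem2p1:
  fixes M :: "'a measure"
    and N X :: "real \<Rightarrow> 'a \<Rightarrow> real"
    and l :: real
  assumes "prob_space M"
    and "measurable_process M N"
    and "stationary_increments M N"
    and "finite_moments M 1 N"
    and "l > 0"
    and "\<And>t \<omega>. X t \<omega> =
           N t \<omega> - l * exp (- l * t) * (LBINT s:{..t}. exp (l * s) * N s \<omega>)"
  shows "(AE \<omega> in M. \<forall>t. set_integrable lborel {..t} (\<lambda>s. exp (l * s) * N s \<omega>)) \<and>
         QOU_process M N l X \<and>
         (\<forall>Y. QOU_process M N l Y \<longrightarrow> equal_in_law M Y X) \<and>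
         (\<forall>p\<ge>1. finite_moments M p N \<longrightarrow> finite_moments M p X \<and> continuous_in_Lp M p X)"
proof (intro conjI allI impI)
  \<comment> \<open>The locale is entered twice: with exponent 1 for existence and laws, and with an
    arbitrary admissible \<open>p\<close> for the moments and continuity.\<close>
  have langevin: "langevin_process M N p l X" if "1 \<le> p" "finite_moments M p N" for p
    by (rule langevin_process.intro[OF
          stationary_increment_process.intro[OF assms(1)
            stationary_increment_process_axioms.intro[OF assms(2,3) that]]
          langevin_process_axioms.intro[OF assms(5,6)]])
  interpret L1: langevin_process M N 1 l X
    by (rule langevin[OF order_refl assms(4)])
  show "AE \<omega> in M. \<forall>t. set_integrable lborel {..t} (\<lambda>s. exp (l * s) * N s \<omega>)"
    by (rule L1.AE_set_integrable)
  show "QOU_process M N l X"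
    by (rule L1.X_QOU[OF refl])
  show "equal_in_law M Y X" if "QOU_process M N l Y" for Y
    by (rule L1.QOU_unique[OF refl that])
  fix p :: real
  assume "1 \<le> p" "finite_moments M p N"
  then interpret Lp: langevin_process M N p l X
    by (rule langevin)
  show "finite_moments M p X"
    using Lp.X_moment_integrable by (simp add: finite_moments_def)
  show "continuous_in_Lp M p X"
    by (rule Lp.X_continuous_in_Lp)
qed

end
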